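(* Let $H$ be a separable Hilbert space, let $(X_t)_{t\geq 1}$ be $H$-valued and $(\epsilon_t)_{t\geq1}$ real-valued, and $(\mathcal{F}_t)_{t\geq 0}$ a filtration such that for all $t\ge1$: $X_t$ is $\mathcal{F}_{t-1}$-measurable, $\epsilon_t$ is $\mathcal{F}_t$-measurable, $\mathbb{E}[\epsilon_t\mid\mathcal{F}_{t-1}]=0$, $|\epsilon_t|\le B$, and $\mathrm{Var}(\epsilon_t\mid\mathcal{F}_{t-1})\le\sigma_t^2$ with $\sigma_t$ $\mathcal{F}_{t-1}$-measurable. Fix $\rho>0$ and set $V_t=\sum_{i\leq t}X_iX_i^T$, $M_t=\sum_{i\le t}X_i\epsilon_i$, $G_t=(\rho I+V_t)^{-1/2}X_t$, $$s_t=\|(\rho I+V_t)^{-1/2}M_t\|,\qquad \nu_t=\sum_{i\le t}\sigma_i^2\|G_i\|^2.$$ Then for every $\theta>0$ and $\delta\in(0,1)$, $$\mathbb{P}\left(\sup_t \frac{(\theta/B^2)^{\theta/B^2}}{\Gamma(\theta/B^2)\,\overline{\gamma}(\theta/B^2,\theta/B^2)}\cdot\frac{\Gamma\big(\frac{Bs_t+\nu_t+\theta}{B^2}\big)\,\overline{\gamma}\big(\frac{Bs_t+\nu_t+\theta}{B^2},\frac{\nu_t+\theta}{B^2}\big)}{\big(\frac{\nu_t+\theta}{B^2}\big)^{\frac{Bs_t+\nu_t+\theta}{B^2}}}\exp\Big(\frac{\nu_t}{B^2}\Big)<\frac{2}{\delta}\right)\ge1-\delta,$$ where $\overline{\gamma}(a,x)=\frac{1}{\Gamma(a)}\int_x^\infty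 u^{a-1}e^{-u}\,du$ is the regularized upper incomplete gamma function.
   Context: For $f,g\in H$, $fg^T$ denotes the operator $f\langle g,\cdot\rangle$ on $H$, and $I$ is the identity operator on $H$. *)

theory Defs
  imports "HOL-Analysis.Analysis" "HOL-Probability.Probability"
begin

definition reg_upper_gamma :: "real \<Rightarrow> real \<Rightarrow> real" where
  "reg_upper_gamma a x = (LBINT u:{x..}. u powr (a - 1) * exp (- u)) / Gamma a"

definition outer :: "'h::real_inner \<Rightarrow> 'h \<Rightarrow> 'h \<Rightarrow> 'h" where
  "outer f g = (\<lambda>x. (g \<bullet> x) *\<^sub>R f)"

definition inv_sqrt_op :: "('h::real_inner \<Rightarrow> 'h) \<Rightarrow> ('h \<Rightarrow> 'h)" where
  "inv_sqrt_op T = (THE S. linear S \<and> (\<forall>x y. S x \<bullet> y = x \<bullet> S y)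
      \<and> (\<forall>x. 0 \<le> x \<bullet> S x) \<and> (\<forall>x. S (S (T x)) = x))"

definition cond_var :: "'a measure \<Rightarrow> 'a measure \<Rightarrow> ('a \<Rightarrow> real) \<Rightarrow> 'a \<Rightarrow> real" where
  "cond_var M F f = real_cond_exp M F (\<lambda>x. (f x - real_cond_exp M F f x)\<^sup>2)"

end

theory Submission
  imports Defs
begin

text \<open>
  Put \<open>\<psi>(l) = (exp (l B) - 1 - l B) / B\<^sup>2\<close> (\<open>bernstein_rate\<close> below).  For every \<open>l \<ge> 0\<close> the process
  \<open>cosh (l s\<^sub>t) exp (- \<psi>(l) \<nu>\<^sub>t)\<close> is a supermartingale: passing from time \<open>t\<close> to \<open>t + 1\<close>, the operator
  \<open>\<rho> I + V\<close> grows, which only shrinks the contribution of \<open>M\<^sub>t\<close>, and the new summand is \<open>\<epsilon> G\<close> with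
  \<open>\<parallel>G\<parallel> \<le> 1\<close>.  As \<open>\<parallel>y + d\<parallel>\<^sup>2\<close> is a convex combination of \<open>(\<parallel>y\<parallel> + \<parallel>d\<parallel>)\<^sup>2\<close> and \<open>(\<parallel>y\<parallel> - \<parallel>d\<parallel>)\<^sup>2\<close>
  and \<open>v \<mapsto> cosh (sqrt v)\<close> is convex, \<open>cosh \<parallel>y + d\<parallel>\<close> is at most a term linear in \<open>d\<close> plus
  \<open>cosh \<parallel>y\<parallel> (exp \<parallel>d\<parallel> - \<parallel>d\<parallel>)\<close>, and the linear term has conditional mean zero.

  Integrating these supermartingales over \<open>l > 0\<close> against \<open>exp (- \<psi>(l) \<theta>)\<close> gives a supermartingale to
  which Ville's inequality applies.  Since \<open>exp x \<le> 2 cosh x\<close>, twice the mixture dominates the integral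
  of \<open>exp (l s\<^sub>t - \<psi>(l) (\<nu>\<^sub>t + \<theta>))\<close>, which the substitution \<open>u = z exp (l B)\<close> with
  \<open>z = (\<nu>\<^sub>t + \<theta>) / B\<^sup>2\<close> turns into the incomplete gamma expression of the theorem.
\<close>

section \<open>The inverse square root of a regularised operator\<close>

text \<open>The library instance requires class \<open>banach\<close> of the codomain, which does not follow from the sort
  \<open>{real_inner, complete_space}\<close>.\<close>

lemma complete_UNIV_blinfun:
  "Topological_Spaces.complete (UNIV :: ('a::real_normed_vector \<Rightarrow>\<^sub>L 'b::{real_normed_vector, complete_space}) set)"
proof (rule completeI)
  fix f :: "nat \<Rightarrow> 'a \<Rightarrow>\<^sub>L 'b"
  assume f: "Cauchy f"
  have "\<exists>v. (\<lambda>n. f n x) \<longlonglongrightarrow> v" for x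
    using bounded_linear.Cauchy[OF blinfun.bounded_linear_left[of x] f]
    by (auto dest!: Cauchy_convergent simp: convergent_def)
  then obtain v where v: "\<And>x. (\<lambda>n. f n x) \<longlonglongrightarrow> v x" by metis
  obtain K where K: "\<And>n. norm (f n) \<le> K"
    using Cauchy_Bseq[OF f] by (auto simp: Bseq_def)
  have "bounded_linear v"
  proof (rule bounded_linear_intro)
    show "v (x + y) = v x + v y" for x y
      using tendsto_add[OF v[of x] v[of y]] v[of "x + y"]
      by (simp add: blinfun.add_right LIMSEQ_unique)
    show "v (c *\<^sub>R x) = c *\<^sub>R v x" for c x
      using tendsto_scaleR[OF tendsto_const[of c] v[of x]] v[of "c *\<^sub>R x"]
      by (simp add: blinfun.scaleR_right LIMSEQ_unique)
    show "norm (v x) \<le> norm x * K" for x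
    proof (rule LIMSEQ_le_const2[OF tendsto_norm[OF v]], intro exI allI impI)
      fix n
      show "norm (f n x) \<le> norm x * K"
        using norm_blinfun[of "f n" x] mult_right_mono[OF K[of n] norm_ge_zero[of x]]
        by (simp add: mult.commute)
    qed
  qed
  then have app: "blinfun_apply (Blinfun v) = v" by (rule bounded_linear_Blinfun_apply)
  have "f \<longlonglongrightarrow> Blinfun v"
  proof (rule LIMSEQ_I)
    fix e :: real assume "e > 0"
    then obtain N where N: "\<And>m n. m \<ge> N \<Longrightarrow> n \<ge> N \<Longrightarrow> norm (f m - f n) < e / 2"
      using CauchyD[OF f, of "e / 2"] by auto
    have "norm (f n - Blinfun v) \<le> e / 2" if "n \<ge> N" for n
    proof (rule norm_blinfun_bound)
      fix x
      have "(\<lambda>m. norm (f n x - f m x)) \<longlonglongrightarrow> norm (f n x - v x)"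
        by (intro tendsto_intros v)
      then have "norm (f n x - v x) \<le> e / 2 * norm x"
      proof (rule LIMSEQ_le_const2, intro exI allI impI)
        fix m assume "N \<le> m"
        then have "norm ((f n - f m) x) \<le> e / 2 * norm x"
          using norm_blinfun[of "f n - f m" x] mult_right_mono[OF less_imp_le[OF N[OF that \<open>N \<le> m\<close>]] norm_ge_zero[of x]]
          by linarith
        then show "norm (f n x - f m x) \<le> e / 2 * norm x"
          by (simp add: blinfun.diff_left)
      qed
      then show "norm ((f n - Blinfun v) x) \<le> e / 2 * norm x"
        by (simp add: blinfun.diff_left app)
    qed (use \<open>e > 0\<close> in simp)
    then show "\<exists>no. \<forall>n\<ge>no. norm (f n - Blinfun v) < e"
      using \<open>e > 0\<close> by (intro exI[of _ N]) (force intro: le_less_trans)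
  qed
  then show "\<exists>l\<in>UNIV. f \<longlonglongrightarrow> l" by blast
qed

text \<open>The operator \<open>I - Y\<close> below is the positive square root of \<open>I - K\<close>.\<close>

lemma exists_quadratic_fixpoint:
  fixes K :: "'h::{real_inner, complete_space} \<Rightarrow>\<^sub>L 'h"
  assumes K: "norm K < 1" and sym: "\<And>x y. K x \<bullet> y = x \<bullet> K y"
  obtains Y :: "'h \<Rightarrow>\<^sub>L 'h" where
    "norm Y < 1" "\<And>x y. Y x \<bullet> y = x \<bullet> Y y" "2 *\<^sub>R Y = K + (Y o\<^sub>L Y)"
    "\<And>Z. Z o\<^sub>L K = K o\<^sub>L Z \<Longrightarrow> Z o\<^sub>L Y = Y o\<^sub>L Z"
proof -
  \<comment> \<open>\<open>r\<close> is the smaller root of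
    \<open>r\<^sup>2 - 2 * r + norm K = 0\<close>. Hence the map \<open>\<phi>\<close> below sends
    the ball of radius \<open>r\<close> into itself, and since \<open>r < 1\<close> the same number
    is its contraction constant there.\<close>
  define r where "r = 1 - sqrt (1 - norm K)"
  have r: "0 \<le> r" "r < 1" and r2: "norm K + r\<^sup>2 = 2 * r"
    using K by (auto simp: r_def power2_diff)
  \<comment> \<open>Symmetry and commutation with everything that commutes with \<open>K\<close> are
    closed conditions preserved by \<open>\<phi>\<close>. Building them into the domain of the
    contraction hands them to the fixed point.\<close>
  define D where "D = Collect (\<lambda>Y :: 'h \<Rightarrow>\<^sub>L 'h. norm Y \<le> r \<and> (\<forall>x y. blinfun_apply Y x \<bullet> y = x \<bullet> blinfun_apply Y y) \<and>
    (\<forall>Z. Z o\<^sub>L K = K o\<^sub>L Z \<longrightarrow> Z o\<^sub>L Y = Y o\<^sub>L Z))"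
  define \<phi> where "\<phi> = (\<lambda>Y :: 'h \<Rightarrow>\<^sub>L 'h. (1/2) *\<^sub>R (K + (Y o\<^sub>L Y)))"
  have "closed {Y :: 'h \<Rightarrow>\<^sub>L 'h. Z o\<^sub>L Y = Y o\<^sub>L Z}" for Z
    by (intro closed_Collect_eq continuous_intros bounded_linear.continuous_on[OF bounded_bilinear.bounded_linear_left[OF bounded_bilinear_blinfun_compose]]
      bounded_linear.continuous_on[OF bounded_bilinear.bounded_linear_right[OF bounded_bilinear_blinfun_compose]])
  then have "closed D"
    unfolding D_def
    by (intro closed_Collect_conj closed_Collect_all closed_Collect_imp closed_Collect_eq closed_Collect_le
        continuous_intros open_Collect_const)
  then have "Topological_Spaces.complete D"
    by (intro complete_closed_subset[OF _ subset_UNIV complete_UNIV_blinfun])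
  moreover have "D \<noteq> {}"
  proof -
    have "0 \<in> D"
      using r by (auto simp: D_def bounded_bilinear.zero_left[OF bounded_bilinear_blinfun_compose]
          bounded_bilinear.zero_right[OF bounded_bilinear_blinfun_compose])
    then show ?thesis by blast
  qed
  moreover have "\<phi> ` D \<subseteq> D"
  proof safe
    fix Y assume "Y \<in> D"
    then have Y: "norm Y \<le> r" "\<And>x y. Y x \<bullet> y = x \<bullet> Y y"
      "\<And>Z. Z o\<^sub>L K = K o\<^sub>L Z \<Longrightarrow> Z o\<^sub>L Y = Y o\<^sub>L Z"
      by (auto simp: D_def)
    have "norm (\<phi> Y) \<le> (1/2) * (norm K + norm Y * norm Y)"
      unfolding \<phi>_def using norm_triangle_ineq[of K "Y o\<^sub>L Y"] norm_blinfun_compose[of Y Y] by simp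
    also have "\<dots> \<le> (1/2) * (norm K + r * r)"
      using mult_mono[OF Y(1) Y(1)] r by simp
    also have "\<dots> = r" using r2 by (simp add: power2_eq_square)
    finally have "norm (\<phi> Y) \<le> r" .
    moreover have "\<phi> Y x \<bullet> y = x \<bullet> \<phi> Y y" for x y
      by (simp add: \<phi>_def blinfun.scaleR_left blinfun.add_left inner_add sym Y(2))
    moreover have "Z o\<^sub>L \<phi> Y = \<phi> Y o\<^sub>L Z" if Z: "Z o\<^sub>L K = K o\<^sub>L Z" for Z
    proof (rule blinfun_eqI)
      fix x
      have 1: "Z (K x) = K (Z x)" for x using arg_cong[OF Z, of "\<lambda>f. blinfun_apply f x"] by simp
      have 2: "Z (Y x) = Y (Z x)" for x using arg_cong[OF Y(3)[OF Z], of "\<lambda>f. blinfun_apply f x"] by simp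
      show "(Z o\<^sub>L \<phi> Y) x = (\<phi> Y o\<^sub>L Z) x"
        by (simp add: \<phi>_def blinfun.scaleR_left blinfun.add_left blinfun.scaleR_right blinfun.add_right 1 2)
    qed
    ultimately show "\<phi> Y \<in> D" by (simp add: D_def)
  qed
  moreover have "dist (\<phi> Y) (\<phi> Y') \<le> r * dist Y Y'" if "Y \<in> D" "Y' \<in> D" for Y Y'
  proof -
    have "\<phi> Y - \<phi> Y' = (1/2) *\<^sub>R ((Y o\<^sub>L (Y - Y')) + ((Y - Y') o\<^sub>L Y'))"
      by (rule blinfun_eqI) (simp add: \<phi>_def blinfun.bilinear_simps algebra_simps)
    also have "norm \<dots> \<le> (1/2) * (norm Y * norm (Y - Y') + norm (Y - Y') * norm Y')"
      using norm_triangle_ineq[of "Y o\<^sub>L (Y - Y')" "(Y - Y') o\<^sub>L Y'"] norm_blinfun_compose[of Y "Y - Y'"]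
        norm_blinfun_compose[of "Y - Y'" Y'] by simp
    also have "\<dots> \<le> (1/2) * (r * norm (Y - Y') + norm (Y - Y') * r)"
      using that by (intro mult_left_mono add_mono mult_right_mono) (auto simp: D_def)
    finally show ?thesis by (simp add: dist_norm)
  qed
  ultimately have "\<exists>!Y\<in>D. \<phi> Y = Y"
    using Banach_fix[of D r \<phi>] r by blast
  then obtain Y where Y: "Y \<in> D" "\<phi> Y = Y" by blast
  have "2 *\<^sub>R \<phi> Y = K + (Y o\<^sub>L Y)" by (simp add: \<phi>_def)
  then have fixpoint: "2 *\<^sub>R Y = K + (Y o\<^sub>L Y)" unfolding Y(2) .
  have D: "norm Y \<le> r" "\<And>x y. Y x \<bullet> y = x \<bullet> Y y" "\<And>Z. Z o\<^sub>L K = K o\<^sub>L Z \<Longrightarrow> Z o\<^sub>L Y = Y o\<^sub>L Z"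
    using Y(1) by (simp_all add: D_def)
  show thesis
    by (rule that[OF _ D(2) fixpoint D(3)]) (use D(1) r in auto)
qed

text \<open>Scaling gives \<open>I - K = \<alpha> R\<close> with \<open>norm K < 1\<close>. The
  fixed point \<open>Y\<close> of \<open>2 Y = K + Y Y\<close> satisfies
  \<open>(I - Y)\<^sup>2 = I - K\<close>, so \<open>Q = (I - Y) / sqrt \<alpha>\<close> is a
  positive root of \<open>R\<close>. Any other root commutes with \<open>K\<close>, hence with
  \<open>Q\<close>, and then equals \<open>Q\<close>; this uniqueness is what gives the definite
  description in \<open>inv_sqrt_op\<close> its value.\<close>

lemma inv_sqrt_op_props:
  fixes T R :: "'h::{real_inner, complete_space} \<Rightarrow> 'h"
  assumes lin: "linear R" and sym: "\<And>x y. R x \<bullet> y = x \<bullet> R y"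
    and bdd: "\<And>x. norm (R x) \<le> L * norm x" and m: "m > 0"
    and coercive: "\<And>x. m * (norm x)\<^sup>2 \<le> x \<bullet> R x"
    and RT: "\<And>x. R (T x) = x" and TR: "\<And>x. T (R x) = x"
  shows "linear (inv_sqrt_op T)" "inv_sqrt_op T x \<bullet> y = x \<bullet> inv_sqrt_op T y"
    "inv_sqrt_op T (inv_sqrt_op T x) = R x"
proof -
  define P where "P = (\<lambda>S. linear S \<and> (\<forall>x y. S x \<bullet> y = x \<bullet> S y)
      \<and> (\<forall>x. 0 \<le> x \<bullet> S x) \<and> (\<forall>x. S (S (T x)) = x))"
  define N where "N = max L m"
  have N: "N > 0" "m \<le> N" and bddN: "norm (R x) \<le> N * norm x" for x
    using m order_trans[OF bdd[of x] mult_right_mono[of L N]] by (auto simp: N_def)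
  \<comment> \<open>This \<open>\<alpha>\<close> minimises
    \<open>1 - 2 * \<alpha> * m + \<alpha>\<^sup>2 * N\<^sup>2\<close>, the bound for
    \<open>(norm K)\<^sup>2\<close> obtained by expanding the square; the minimum is
    \<open>1 - (m / N)\<^sup>2\<close>.\<close>
  define \<alpha> where "\<alpha> = m / N\<^sup>2"
  have \<alpha>: "\<alpha> > 0" using m N by (simp add: \<alpha>_def)
  define K where "K = Blinfun (\<lambda>x. x - \<alpha> *\<^sub>R R x)"
  have Rbl: "bounded_linear R"
    using lin bddN by (intro bounded_linear_intro[of _ N]) (auto simp: linear_add linear_scale mult.commute)
  have K: "K x = x - \<alpha> *\<^sub>R R x" for x
    unfolding K_def
    by (subst bounded_linear_Blinfun_apply)
      (auto intro!: bounded_linear_sub bounded_linear_ident bounded_linear_compose[OF bounded_linear_scaleR_right Rbl])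
  have "norm K \<le> sqrt (1 - (m / N)\<^sup>2)"
  proof (rule norm_blinfun_bound)
    show "0 \<le> sqrt (1 - (m / N)\<^sup>2)"
      using m N by (auto simp: power_le_one)
    fix x
    have "(norm (K x))\<^sup>2 = (norm x)\<^sup>2 - 2 * \<alpha> * (x \<bullet> R x) + \<alpha>\<^sup>2 * (norm (R x))\<^sup>2"
      unfolding K power2_norm_eq_inner by (simp add: inner_diff inner_commute power2_eq_square algebra_simps)
    also have "\<dots> \<le> (norm x)\<^sup>2 - 2 * \<alpha> * (m * (norm x)\<^sup>2) + \<alpha>\<^sup>2 * (N * norm x)\<^sup>2"
      using coercive[of x] bddN[of x] \<alpha>
      by (intro add_mono diff_mono mult_left_mono power_mono) auto
    also have "\<dots> = (1 - (m / N)\<^sup>2) * (norm x)\<^sup>2"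
      using N by (simp add: \<alpha>_def power2_eq_square field_simps)
    finally show "norm (K x) \<le> sqrt (1 - (m / N)\<^sup>2) * norm x"
      by (auto dest!: real_le_rsqrt simp: real_sqrt_mult)
  qed
  also have "\<dots> < 1" using m N by simp
  finally have "norm K < 1" .
  moreover have "K x \<bullet> y = x \<bullet> K y" for x y
    by (simp add: K inner_diff sym)
  ultimately obtain Y :: "'h \<Rightarrow>\<^sub>L 'h" where Y: "norm Y < 1" "\<And>x y. Y x \<bullet> y = x \<bullet> Y y"
    "2 *\<^sub>R Y = K + (Y o\<^sub>L Y)" and comm: "\<And>Z. Z o\<^sub>L K = K o\<^sub>L Z \<Longrightarrow> Z o\<^sub>L Y = Y o\<^sub>L Z"
    using exists_quadratic_fixpoint by blast
  define Q where "Q = (\<lambda>x. (1 / sqrt \<alpha>) *\<^sub>R (x - Y x))"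
  have Qlin: "linear Q"
    by (intro linearI) (simp_all add: Q_def blinfun.add_right blinfun.scaleR_right algebra_simps)
  have Qsym: "Q x \<bullet> y = x \<bullet> Q y" for x y
    by (simp add: Q_def inner_diff Y(2))
  have Qcoercive: "(1 - norm Y) / sqrt \<alpha> * (norm x)\<^sup>2 \<le> x \<bullet> Q x" for x
  proof -
    have "x \<bullet> Y x \<le> norm x * norm (Y x)" by (rule norm_cauchy_schwarz)
    also have "\<dots> \<le> norm x * (norm Y * norm x)" by (intro mult_left_mono norm_blinfun) simp
    finally have "(1 - norm Y) * (norm x)\<^sup>2 \<le> x \<bullet> (x - Y x)"
      by (simp add: inner_diff power2_norm_eq_inner[symmetric] power2_eq_square algebra_simps)
    then show ?thesis using \<alpha> by (simp add: Q_def divide_right_mono)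
  qed
  have QQ: "Q (Q x) = R x" for x
  proof -
    have "2 *\<^sub>R Y x = K x + Y (Y x)"
      using arg_cong[OF Y(3), of "\<lambda>f. blinfun_apply f x"] by (simp add: blinfun.scaleR_left blinfun.add_left)
    moreover have "x - Y x - Y (x - Y x) = x - 2 *\<^sub>R Y x + Y (Y x)"
      by (simp add: blinfun.diff_right scaleR_2)
    ultimately have "x - Y x - Y (x - Y x) = \<alpha> *\<^sub>R R x" by (simp add: K)
    moreover have "Q (Q x) = (1 / \<alpha>) *\<^sub>R (x - Y x - Y (x - Y x))"
      using \<alpha> by (simp add: Q_def blinfun.scaleR_right scaleR_diff_right[symmetric] real_sqrt_mult_self)
    ultimately show ?thesis using \<alpha> by simp
  qed
  have QP: "P Q"
    unfolding P_def using Qlin Qsym QQ RT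
    by (auto intro: order_trans[OF _ Qcoercive] simp: Y(1) less_imp_le \<alpha>)
  moreover have "S = Q" if "P S" for S
  proof
    fix x
    have S: "linear S" "\<And>x y. S x \<bullet> y = x \<bullet> S y" "\<And>x. 0 \<le> x \<bullet> S x" "\<And>x. S (S (T x)) = x"
      using that by (auto simp: P_def)
    have SS: "S (S x) = R x" for x using S(4)[of "R x"] TR by simp
    \<comment> \<open>\<open>inv_sqrt_op\<close> asks only for linearity. Boundedness comes from
      \<open>S S = R\<close> and is needed before \<open>comm\<close> can be applied to
      \<open>S\<close> as a bounded operator.\<close>
    have "bounded_linear S"
    proof (rule bounded_linear_intro)
      show "norm (S x) \<le> norm x * sqrt N" for x
      proof -
        have "(norm (S x))\<^sup>2 = x \<bullet> R x"
          by (simp add: power2_norm_eq_inner S(2) SS)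
        also have "\<dots> \<le> norm x * (N * norm x)"
          using norm_cauchy_schwarz[of x "R x"] mult_left_mono[OF bddN[of x], of "norm x"] by simp
        also have "\<dots> = (norm x * sqrt N)\<^sup>2"
          using N by (simp add: power2_eq_square algebra_simps)
        finally show ?thesis by (rule power2_le_imp_le) (use N in simp)
      qed
    qed (simp_all add: S(1) linear_add linear_scale)
    then have app: "blinfun_apply (Blinfun S) = S" by (rule bounded_linear_Blinfun_apply)
    have "Blinfun S o\<^sub>L K = K o\<^sub>L Blinfun S"
      by (rule blinfun_eqI)
        (simp add: app K SS[symmetric] linear_diff[OF S(1)] linear_scale[OF S(1)])
    from comm[OF this] have SY: "S (Y x) = Y (S x)"
      by (metis app blinfun_apply_blinfun_compose)
    \<comment> \<open>The roots commute, so \<open>(S + Q) (S - Q) = S S - Q Q = 0\<close>. Pairing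
      \<open>S y + Q y = 0\<close> with \<open>y\<close> leaves two nonnegative terms, and
      coercivity of \<open>Q\<close> forces \<open>y = 0\<close>.\<close>
    define y where "y = S x - Q x"
    have "S (Q x) = Q (S x)"
      by (simp add: Q_def SY linear_diff[OF S(1)] linear_scale[OF S(1)])
    then have "S y + Q y = 0"
      by (simp add: y_def linear_diff[OF S(1)] linear_diff[OF Qlin] SS QQ)
    then have "y \<bullet> S y + y \<bullet> Q y = 0" by (metis inner_add_right inner_zero_right)
    then have "(1 - norm Y) / sqrt \<alpha> * (norm y)\<^sup>2 \<le> 0"
      using Qcoercive[of y] S(3)[of y] by linarith
    then have "y = 0"
      using Y(1) \<alpha> by (auto simp: mult_le_0_iff divide_le_0_iff)
    then show "S x = Q x" by (simp add: y_def)
  qed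
  ultimately have "inv_sqrt_op T = Q"
    unfolding inv_sqrt_op_def P_def[symmetric] by (rule the_equality)
  then show "linear (inv_sqrt_op T)" "inv_sqrt_op T x \<bullet> y = x \<bullet> inv_sqrt_op T y"
    "inv_sqrt_op T (inv_sqrt_op T x) = R x"
    using Qlin Qsym QQ by simp_all
qed

text \<open>The inverse of \<open>\<rho> I + \<Sum>i\<le>t. x\<^sub>i x\<^sub>i\<^sup>T\<close>, built up by the Sherman--Morrison formula.\<close>

fun reg_inv :: "real \<Rightarrow> (nat \<Rightarrow> 'h::real_inner) \<Rightarrow> nat \<Rightarrow> 'h \<Rightarrow> 'h" where
  "reg_inv \<rho> x 0 v = (1 / \<rho>) *\<^sub>R v"
| "reg_inv \<rho> x (Suc t) v = reg_inv \<rho> x t v -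
     (x (Suc t) \<bullet> reg_inv \<rho> x t v / (1 + x (Suc t) \<bullet> reg_inv \<rho> x t (x (Suc t)))) *\<^sub>R reg_inv \<rho> x t (x (Suc t))"

definition reg_op :: "real \<Rightarrow> (nat \<Rightarrow> 'h::real_inner) \<Rightarrow> nat \<Rightarrow> 'h \<Rightarrow> 'h" where
  "reg_op \<rho> x t = (\<lambda>v. \<rho> *\<^sub>R v + (\<Sum>i\<in>{1..t}. outer (x i) (x i) v))"

lemma linear_reg_op: "linear (reg_op \<rho> x t)"
  by (intro linearI) (simp_all add: reg_op_def outer_def inner_add_right scaleR_add_left scaleR_add_right
    sum.distrib scaleR_sum_right)

lemma inner_reg_op: "v \<bullet> reg_op \<rho> x t v = \<rho> * (norm v)\<^sup>2 + (\<Sum>i\<in>{1..t}. (x i \<bullet> v)\<^sup>2)"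
  by (simp add: reg_op_def outer_def inner_add_right inner_sum_right dot_square_norm power2_eq_square inner_commute)

lemma linear_reg_inv: "linear (reg_inv \<rho> x t)"
proof (induction t)
  case 0
  show ?case by (intro linearI) (simp_all add: algebra_simps)
next
  case (Suc t)
  show ?case
    by (intro linearI)
      (simp_all add: linear_add[OF Suc] linear_scale[OF Suc] inner_add_right add_divide_distrib algebra_simps)
qed

lemma reg_inv_sym: "reg_inv \<rho> x t v \<bullet> w = v \<bullet> reg_inv \<rho> x t w"
proof (induction t arbitrary: v w)
  case (Suc t)
  have "reg_inv \<rho> x t (x (Suc t)) \<bullet> w = x (Suc t) \<bullet> reg_inv \<rho> x t w"
    "v \<bullet> reg_inv \<rho> x t (x (Suc t)) = x (Suc t) \<bullet> reg_inv \<rho> x t v"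
    using Suc[of "x (Suc t)" w] Suc[of "x (Suc t)" v] by (simp_all add: inner_commute)
  then show ?case by (simp add: inner_diff Suc[of v w])
qed simp

lemma reg_op_reg_inv:
  assumes "\<rho> > 0"
  shows "reg_op \<rho> x t (reg_inv \<rho> x t v) = v"
proof (induction t arbitrary: v)
  case 0
  then show ?case using assms by (simp add: reg_op_def)
next
  case (Suc t)
  let ?u = "x (Suc t)"
  define q where "q = ?u \<bullet> reg_inv \<rho> x t ?u"
  define p where "p = ?u \<bullet> reg_inv \<rho> x t v"
  have q: "1 + q > 0"
  proof -
    have "reg_inv \<rho> x t ?u \<bullet> reg_op \<rho> x t (reg_inv \<rho> x t ?u) \<ge> 0"
      unfolding inner_reg_op using assms by (auto intro!: add_nonneg_nonneg sum_nonneg)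
    then show ?thesis unfolding Suc by (simp add: q_def inner_commute)
  qed
  let ?w = "reg_inv \<rho> x t v - (p / (1 + q)) *\<^sub>R reg_inv \<rho> x t ?u"
  have "reg_op \<rho> x (Suc t) ?w = reg_op \<rho> x t ?w + (?u \<bullet> ?w) *\<^sub>R ?u"
    by (simp add: reg_op_def outer_def)
  also have "reg_op \<rho> x t ?w = v - (p / (1 + q)) *\<^sub>R ?u"
    using linear_diff[OF linear_reg_op[of \<rho> x t]] linear_scale[OF linear_reg_op[of \<rho> x t]] Suc by simp
  also have "?u \<bullet> ?w = p - p / (1 + q) * q"
    by (simp add: inner_diff p_def q_def)
  also have "\<dots> = p / (1 + q)" using q by (simp add: field_simps)
  finally show ?case by (simp add: p_def q_def)
qed

text \<open>Substituting \<open>reg_op (reg_inv v)\<close> for \<open>v\<close> turns the left side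
  into the quadratic form of \<open>reg_op\<close> at \<open>reg_inv v\<close>, whose rank-one terms
  are nonnegative.\<close>

lemma inner_reg_inv:
  assumes "\<rho> > 0"
  shows "v \<bullet> reg_inv \<rho> x t v \<ge> \<rho> * (norm (reg_inv \<rho> x t v))\<^sup>2"
proof -
  have "v \<bullet> reg_inv \<rho> x t v = reg_inv \<rho> x t v \<bullet> reg_op \<rho> x t (reg_inv \<rho> x t v)"
    using assms by (simp only: reg_op_reg_inv) (simp add: inner_commute)
  then show ?thesis unfolding inner_reg_op by (simp add: sum_nonneg)
qed

lemma inner_reg_inv_nonneg:
  assumes "\<rho> > 0"
  shows "v \<bullet> reg_inv \<rho> x t v \<ge> 0"
  using inner_reg_inv[OF assms, of x t v] assms by (auto intro: order_trans[rotated])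

text \<open>In infinite dimension a right inverse need not be a left inverse. Here
  \<open>reg_op\<close> is injective, because its quadratic form is at least \<rho> times the
  squared norm.\<close>

lemma reg_inv_reg_op:
  assumes "\<rho> > 0"
  shows "reg_inv \<rho> x t (reg_op \<rho> x t v) = v"
proof -
  define w where "w = reg_inv \<rho> x t (reg_op \<rho> x t v) - v"
  have "reg_op \<rho> x t w = 0"
    unfolding w_def linear_diff[OF linear_reg_op] reg_op_reg_inv[OF assms] by simp
  then have "w \<bullet> reg_op \<rho> x t w = 0" by simp
  then have "\<rho> * (norm w)\<^sup>2 + (\<Sum>i\<in>{1..t}. (x i \<bullet> w)\<^sup>2) = 0" unfolding inner_reg_op .
  moreover have "(\<Sum>i\<in>{1..t}. (x i \<bullet> w)\<^sup>2) \<ge> 0" by (simp add: sum_nonneg)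
  moreover have "\<rho> * (norm w)\<^sup>2 \<ge> 0" using assms by simp
  ultimately have "\<rho> * (norm w)\<^sup>2 = 0" by linarith
  then show ?thesis using assms by (simp add: w_def)
qed

lemma norm_reg_op_le:
  assumes "\<rho> > 0"
  shows "norm (reg_op \<rho> x t v) \<le> (\<rho> + (\<Sum>i\<in>{1..t}. (norm (x i))\<^sup>2)) * norm v"
proof -
  have "norm (\<Sum>i\<in>{1..t}. outer (x i) (x i) v) \<le> (\<Sum>i\<in>{1..t}. (norm (x i))\<^sup>2 * norm v)"
  proof (rule sum_norm_le)
    fix i
    show "norm (outer (x i) (x i) v) \<le> (norm (x i))\<^sup>2 * norm v"
      using mult_right_mono[OF Cauchy_Schwarz_ineq2[of "x i" v] norm_ge_zero[of "x i"]]
      by (simp add: outer_def power2_eq_square mult_ac)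
  qed
  then show ?thesis
    using norm_triangle_ineq[of "\<rho> *\<^sub>R v" "\<Sum>i\<in>{1..t}. outer (x i) (x i) v"] assms
    by (simp add: reg_op_def distrib_right sum_distrib_right)
qed

text \<open>Linearity and this identity are all that is used about the square root afterwards: norms
  and inner products of its values become expressions in \<open>reg_inv\<close>.\<close>

lemma inv_sqrt_reg_op:
  fixes x :: "nat \<Rightarrow> 'h::{real_inner, complete_space}" and t :: nat
  assumes \<rho>: "\<rho> > 0"
  defines "W \<equiv> inv_sqrt_op (reg_op \<rho> x t)"
  shows "linear W" "W v \<bullet> W w = v \<bullet> reg_inv \<rho> x t w"
proof -
  define N where "N = \<rho> + (\<Sum>i\<in>{1..t}. (norm (x i))\<^sup>2)"
  have N: "N > 0" using \<rho> by (auto simp: N_def intro!: add_pos_nonneg sum_nonneg)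
  have bdd: "norm (reg_inv \<rho> x t v) \<le> 1 / \<rho> * norm v" for v
  proof (cases "reg_inv \<rho> x t v = 0")
    case False
    have "\<rho> * (norm (reg_inv \<rho> x t v))\<^sup>2 \<le> norm v * norm (reg_inv \<rho> x t v)"
      using inner_reg_inv[OF \<rho>, of x t v] norm_cauchy_schwarz[of v "reg_inv \<rho> x t v"] by linarith
    with False have "\<rho> * norm (reg_inv \<rho> x t v) \<le> norm v"
      by (simp add: power2_eq_square mult.assoc[symmetric])
    then show ?thesis using \<rho> by (simp add: field_simps)
  qed (use \<rho> in simp)
  \<comment> \<open>A lower bound for the inverse requires an upper bound for the operator:
    \<open>N\<close> bounds \<open>reg_op\<close>, so \<open>norm v\<close> is at most
    \<open>N\<close> times the norm of \<open>reg_inv v\<close>.\<close>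
  have coercive: "\<rho> / N\<^sup>2 * (norm v)\<^sup>2 \<le> v \<bullet> reg_inv \<rho> x t v" for v
  proof -
    have "norm v \<le> N * norm (reg_inv \<rho> x t v)"
      using norm_reg_op_le[OF \<rho>, of x t "reg_inv \<rho> x t v"] unfolding reg_op_reg_inv[OF \<rho>] N_def .
    then have "(norm v)\<^sup>2 \<le> N\<^sup>2 * (norm (reg_inv \<rho> x t v))\<^sup>2"
      by (metis norm_ge_zero power_mono power_mult_distrib)
    then have "\<rho> / N\<^sup>2 * (norm v)\<^sup>2 \<le> \<rho> * (norm (reg_inv \<rho> x t v))\<^sup>2"
      using N \<rho> by (simp add: field_simps)
    then show ?thesis using inner_reg_inv[OF \<rho>, of x t v] by linarith
  qed
  have pos: "\<rho> / N\<^sup>2 > 0" using \<rho> N by simp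
  note * = inv_sqrt_op_props[OF linear_reg_inv reg_inv_sym bdd pos coercive reg_inv_reg_op[OF \<rho>] reg_op_reg_inv[OF \<rho>]]
  show "linear W" unfolding W_def using \<rho> N by (simp add: *)
  show "W v \<bullet> W w = v \<bullet> reg_inv \<rho> x t w"
    unfolding W_def using \<rho> N by (simp add: *)
qed

text \<open>By symmetry the Sherman-Morrison correction subtracts a square divided by a positive
  number.\<close>

lemma inner_reg_inv_Suc_le:
  assumes "\<rho> > 0"
  shows "v \<bullet> reg_inv \<rho> x (Suc t) v \<le> v \<bullet> reg_inv \<rho> x t v"
proof -
  let ?u = "x (Suc t)"
  have "v \<bullet> reg_inv \<rho> x t ?u = ?u \<bullet> reg_inv \<rho> x t v"
    using reg_inv_sym[of \<rho> x t v ?u] by (simp add: inner_commute)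
  moreover have "?u \<bullet> reg_inv \<rho> x t ?u \<ge> 0" using assms by (rule inner_reg_inv_nonneg)
  ultimately show ?thesis by (simp add: inner_diff_right)
qed

text \<open>The new quadratic form equals \<open>q / (1 + q)\<close>, where \<open>q\<close> is the
  old one. This is the bound of \<open>norm G\<close> by 1.\<close>

lemma inner_reg_inv_Suc_le_1:
  assumes "\<rho> > 0"
  shows "x (Suc t) \<bullet> reg_inv \<rho> x (Suc t) (x (Suc t)) \<le> 1"
proof -
  define q where "q = x (Suc t) \<bullet> reg_inv \<rho> x t (x (Suc t))"
  have "q \<ge> 0" unfolding q_def using assms by (rule inner_reg_inv_nonneg)
  then have "q - q / (1 + q) * q \<le> 1" by (simp add: field_simps)
  then show ?thesis by (simp add: inner_diff_right q_def)
qed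

section \<open>Hyperbolic cosine of a perturbed norm\<close>

lemma power_convex_comb_le:
  fixes u v p :: real
  assumes "0 \<le> u" "0 \<le> v" "0 \<le> p" "p \<le> 1"
  shows "(p * u + (1 - p) * v) ^ n \<le> p * u ^ n + (1 - p) * v ^ n"
proof -
  have "convex_on {0..} (\<lambda>x::real. x ^ n)"
    by (cases "even n") (auto intro: convex_power_odd convex_on_subset[OF convex_power_even])
  from convex_onD[OF this, of "1 - p" u v] show ?thesis
    using assms by simp
qed

text \<open>This is convexity of \<open>v \<mapsto> cosh (sqrt v)\<close>, whose power series has nonnegative coefficients.\<close>

lemma cosh_convex_square:
  fixes a b w p :: real
  assumes "0 \<le> p" "p \<le> 1" and w: "w\<^sup>2 = p * a\<^sup>2 + (1 - p) * b\<^sup>2"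
  shows "cosh w \<le> p * cosh a + (1 - p) * cosh b"
proof (rule sums_le)
  show "(\<lambda>n. if even n then w ^ n /\<^sub>R fact n else 0) sums cosh w"
    by (rule cosh_converges)
  show "(\<lambda>n. p * (if even n then a ^ n /\<^sub>R fact n else 0) + (1 - p) * (if even n then b ^ n /\<^sub>R fact n else 0))
      sums (p * cosh a + (1 - p) * cosh b)"
    by (intro sums_add sums_mult cosh_converges)
  fix n
  show "(if even n then w ^ n /\<^sub>R fact n else 0)
      \<le> p * (if even n then a ^ n /\<^sub>R fact n else 0) + (1 - p) * (if even n then b ^ n /\<^sub>R fact n else 0)"
  proof (cases "even n")
    case True
    then obtain k where n: "n = 2 * k" by blast
    have "w ^ n \<le> p * a ^ n + (1 - p) * b ^ n"
      unfolding n power_mult w using assms(1,2) by (intro power_convex_comb_le) auto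
    then have "w ^ n / fact n \<le> (p * a ^ n + (1 - p) * b ^ n) / fact n"
      by (intro divide_right_mono) auto
    then show ?thesis using True by (simp add: field_simps)
  qed simp
qed

text \<open>Let \<open>\<kappa>\<close> be the cosine of the angle between \<open>y\<close> and
  \<open>d\<close>. The squared norm of the sum is the convex combination, with weight
  \<open>(1 + \<kappa>) / 2\<close>, of the squares of the sum and the difference of the two norms,
  and the addition formulas recombine the result. If a vector vanishes, division by zero makes the
  last term 0.\<close>

lemma cosh_norm_add_le_cosh_cosh:
  fixes y d :: "'h::real_inner"
  shows "cosh (norm (y + d)) \<le> cosh (norm y) * cosh (norm d) +
    (y \<bullet> d) / (norm y * norm d) * (sinh (norm y) * sinh (norm d))"
proof (cases "y = 0 \<or> d = 0")
  case False
  define r where "r = norm y"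
  define e where "e = norm d"
  define \<kappa> where "\<kappa> = (y \<bullet> d) / (r * e)"
  have re: "r > 0" "e > 0" using False by (auto simp: r_def e_def)
  have "\<bar>y \<bullet> d\<bar> \<le> r * e" unfolding r_def e_def by (rule Cauchy_Schwarz_ineq2)
  then have \<kappa>: "-1 \<le> \<kappa>" "\<kappa> \<le> 1" using re by (auto simp: \<kappa>_def field_simps)
  have "(norm (y + d))\<^sup>2 = r\<^sup>2 + 2 * (\<kappa> * (r * e)) + e\<^sup>2"
    using re by (simp add: r_def e_def \<kappa>_def power2_norm_eq_inner inner_add inner_commute)
  also have "\<dots> = (1 + \<kappa>) / 2 * (r + e)\<^sup>2 + (1 - (1 + \<kappa>) / 2) * (r - e)\<^sup>2"
    by (simp add: power2_eq_square field_simps)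
  finally have "cosh (norm (y + d)) \<le> (1 + \<kappa>) / 2 * cosh (r + e) + (1 - (1 + \<kappa>) / 2) * cosh (r - e)"
    using \<kappa> by (intro cosh_convex_square) auto
  also have "\<dots> = cosh r * cosh e + \<kappa> * (sinh r * sinh e)"
    by (simp add: cosh_add cosh_diff field_simps)
  finally show ?thesis by (simp add: \<kappa>_def r_def e_def)
qed auto

lemma le_sinh: "0 \<le> x \<Longrightarrow> x \<le> sinh x" for x :: real
  using real_le_x_sinh[of x] by (simp add: sinh_field_def exp_minus)

text \<open>Write \<open>sinh e = e + (sinh e - e)\<close> for \<open>e = norm d\<close>. The first
  part gives exactly the term linear in \<open>d\<close>, which must survive without absolute values
  in order to average out. The nonnegative rest is controlled by
  \<open>\<kappa> * sinh r \<le> cosh r\<close>, and \<open>cosh e + sinh e = exp e\<close>.\<close>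

lemma cosh_norm_add_le:
  fixes y d :: "'h::real_inner"
  shows "cosh (norm (y + d)) \<le> cosh (norm y) * (exp (norm d) - norm d) + sinh (norm y) / norm y * (y \<bullet> d)"
proof -
  define r where "r = norm y"
  define e where "e = norm d"
  define \<kappa> where "\<kappa> = (y \<bullet> d) / (r * e)"
  have "\<bar>y \<bullet> d\<bar> \<le> r * e" unfolding r_def e_def by (rule Cauchy_Schwarz_ineq2)
  then have \<kappa>: "\<bar>\<kappa>\<bar> \<le> 1"
    unfolding \<kappa>_def abs_divide by (auto simp: r_def e_def divide_le_eq_1 abs_mult)
  have "\<kappa> * sinh r \<le> 1 * cosh r"
  proof -
    have "\<kappa> * sinh r \<le> \<bar>\<kappa>\<bar> * sinh r" by (intro mult_right_mono) (auto simp: r_def)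
    also have "\<dots> \<le> 1 * sinh r" by (intro mult_right_mono \<kappa>) (auto simp: r_def)
    finally show ?thesis using sinh_le_cosh_real[of r] by simp
  qed
  then have "\<kappa> * sinh r * (sinh e - e) \<le> cosh r * (sinh e - e)"
    using le_sinh[of e] by (intro mult_right_mono) (auto simp: e_def)
  moreover have "\<kappa> * sinh r * e = sinh r / r * (y \<bullet> d)"
    by (cases "e = 0") (auto simp: \<kappa>_def e_def)
  moreover have "cosh (norm (y + d)) \<le> cosh r * cosh e + \<kappa> * (sinh r * sinh e)"
    using cosh_norm_add_le_cosh_cosh[of y d] by (simp add: r_def e_def \<kappa>_def)
  ultimately have "cosh (norm (y + d)) \<le> cosh r * (cosh e + sinh e - e) + sinh r / r * (y \<bullet> d)"
    by (simp add: algebra_simps)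
  then show ?thesis by (simp add: cosh_plus_sinh r_def e_def)
qed

text \<open>The quotient \<open>(exp x - 1 - x) / x\<^sup>2\<close> is increasing, as its power
  series has nonnegative coefficients. The cross-multiplied form admits zero.\<close>

lemma exp_remainder_le:
  fixes x b :: real
  assumes "0 \<le> x" "x \<le> b"
  shows "(exp x - 1 - x) * b\<^sup>2 \<le> (exp b - 1 - b) * x\<^sup>2"
proof (rule sums_le)
  have *: "(\<lambda>n. y ^ (n + 2) / fact (n + 2)) sums (exp y - 1 - y)" for y :: real
    using sums_split_initial_segment[OF exp_converges[of y], of 2]
    by (simp add: numeral_2_eq_2 divide_inverse_commute algebra_simps)
  show "(\<lambda>n. x ^ (n + 2) / fact (n + 2) * b\<^sup>2) sums ((exp x - 1 - x) * b\<^sup>2)"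
    "(\<lambda>n. b ^ (n + 2) / fact (n + 2) * x\<^sup>2) sums ((exp b - 1 - b) * x\<^sup>2)"
    by (intro sums_mult2 *)+
  fix n
  have "x ^ n * (x\<^sup>2 * b\<^sup>2) / fact (n + 2) \<le> b ^ n * (x\<^sup>2 * b\<^sup>2) / fact (n + 2)"
    using assms by (intro divide_right_mono mult_right_mono power_mono) auto
  then show "x ^ (n + 2) / fact (n + 2) * b\<^sup>2 \<le> b ^ (n + 2) / fact (n + 2) * x\<^sup>2"
    unfolding power_add by (simp only: mult_ac times_divide_eq_left times_divide_eq_right)
qed

text \<open>This is the logarithmic moment generating function, at \<open>l\<close>, of a centred
  Poisson variable scaled to jumps of size \<open>B\<close> and variance 1.\<close>

definition bernstein_rate :: "real \<Rightarrow> real \<Rightarrow> real" where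
  "bernstein_rate B l = (exp (l * B) - 1 - l * B) / B\<^sup>2"

lemma bernstein_rate_nonneg: "0 \<le> bernstein_rate B l"
proof -
  have "0 \<le> exp (l * B) - 1 - l * B" using exp_ge_add_one_self[of "l * B"] by linarith
  then show ?thesis by (simp add: bernstein_rate_def del: diff_ge_0_iff_ge)
qed

lemma borel_measurable_bernstein_rate [measurable]: "bernstein_rate B \<in> borel_measurable borel"
  unfolding bernstein_rate_def[abs_def] by measurable

lemma exp_remainder_le_bernstein_rate:
  assumes "B > 0" "0 \<le> x" "x \<le> B" "0 \<le> l"
  shows "exp (l * x) - 1 - l * x \<le> bernstein_rate B l * x\<^sup>2"
proof (cases "l = 0")
  case False
  have "(exp (l * x) - 1 - l * x) * (l * B)\<^sup>2 \<le> (exp (l * B) - 1 - l * B) * (l * x)\<^sup>2"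
    using assms by (intro exp_remainder_le mult_nonneg_nonneg mult_left_mono)
  then have "l\<^sup>2 * ((exp (l * x) - 1 - l * x) * B\<^sup>2) \<le> l\<^sup>2 * ((exp (l * B) - 1 - l * B) * x\<^sup>2)"
    by (simp add: power_mult_distrib mult_ac)
  then have "(exp (l * x) - 1 - l * x) * B\<^sup>2 \<le> (exp (l * B) - 1 - l * B) * x\<^sup>2"
    using False by simp
  then show ?thesis
    using assms(1) by (simp add: bernstein_rate_def pos_le_divide_eq)
qed (simp add: bernstein_rate_def)

text \<open>\<open>cosh_norm_add_le\<close> is applied to \<open>l *\<^sub>R y\<close> and
  \<open>(l * e) *\<^sub>R g\<close>. Since the perturbation has norm at most \<open>B\<close>
  before scaling by \<open>l\<close>, its exponential remainder is bounded by a multiple of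
  \<open>e\<^sup>2\<close>. What results is a quadratic polynomial in \<open>e\<close>, ready for
  conditioning.\<close>

lemma cosh_norm_step:
  fixes y g :: "'h::real_inner"
  assumes "B > 0" "0 \<le> l" "\<bar>e\<bar> \<le> B" "norm g \<le> 1"
  shows "cosh (l * norm (y + e *\<^sub>R g)) \<le> cosh (l * norm y) * (1 + bernstein_rate B l * (norm g)\<^sup>2 * e\<^sup>2) +
    l * sinh (l * norm y) * ((y \<bullet> g) / norm y) * e"
proof (cases "l = 0")
  case True
  then show ?thesis by (simp add: bernstein_rate_def)
next
  case False
  then have l: "l > 0" using assms by simp
  have "\<bar>e\<bar> * norm g \<le> B * 1" using assms by (intro mult_mono) auto
  then have "exp (l * (\<bar>e\<bar> * norm g)) - 1 - l * (\<bar>e\<bar> * norm g) \<le> bernstein_rate B l * (\<bar>e\<bar> * norm g)\<^sup>2"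
    using assms by (intro exp_remainder_le_bernstein_rate) auto
  then have "exp (l * (\<bar>e\<bar> * norm g)) - l * (\<bar>e\<bar> * norm g) \<le> 1 + bernstein_rate B l * (norm g)\<^sup>2 * e\<^sup>2"
    by (simp add: power_mult_distrib mult_ac)
  then have 1: "cosh (l * norm y) * (exp (l * (\<bar>e\<bar> * norm g)) - l * (\<bar>e\<bar> * norm g)) \<le>
      cosh (l * norm y) * (1 + bernstein_rate B l * (norm g)\<^sup>2 * e\<^sup>2)"
    by (intro mult_left_mono) auto
  have 2: "cosh (norm (l *\<^sub>R y + (l * e) *\<^sub>R g)) \<le>
    cosh (l * norm y) * (exp (l * (\<bar>e\<bar> * norm g)) - l * (\<bar>e\<bar> * norm g)) +
      sinh (l * norm y) / (l * norm y) * (l *\<^sub>R y \<bullet> ((l * e) *\<^sub>R g))"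
    using cosh_norm_add_le[of "l *\<^sub>R y" "(l * e) *\<^sub>R g"] l by (simp add: abs_mult mult_ac)
  have "l *\<^sub>R y + (l * e) *\<^sub>R g = l *\<^sub>R (y + e *\<^sub>R g)" by (simp add: algebra_simps)
  then have 3: "norm (l *\<^sub>R y + (l * e) *\<^sub>R g) = l * norm (y + e *\<^sub>R g)" using l by simp
  have 4: "sinh (l * norm y) / (l * norm y) * (l *\<^sub>R y \<bullet> ((l * e) *\<^sub>R g)) =
     l * sinh (l * norm y) * ((y \<bullet> g) / norm y) * e"
    using l by (simp add: mult_ac)
  show ?thesis using 1 2 unfolding 3 4 by linarith
qed

section \<open>Exponential mixtures and the incomplete gamma function\<close>

text \<open>The factor \<open>Gamma a\<close> cancels the normalisation, and the endpoint is a null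
  set. The open ray fits the open intervals of the substitution rule used below.\<close>

lemma Gamma_reg_upper_gamma:
  fixes a z :: real
  assumes "a > 0"
  shows "Gamma a * reg_upper_gamma a z = (LBINT u:{z<..}. u powr (a - 1) * exp (- u))"
proof -
  have "(LBINT u:{z<..}. u powr (a - 1) * exp (- u)) = (LBINT u:{z..}. u powr (a - 1) * exp (- u))"
    unfolding set_lebesgue_integral_def
  proof (rule integral_cong_AE)
    show "AE u in lborel. indicator {z<..} u *\<^sub>R (u powr (a - 1) * exp (- u)) =
        indicator {z..} u *\<^sub>R (u powr (a - 1) * exp (- u))"
      using AE_lborel_singleton[of z] by eventually_elim (auto simp: indicator_def)
  qed auto
  then show ?thesis using Gamma_real_pos[OF assms] by (simp add: reg_upper_gamma_def)
qed

lemma set_integrable_upper_gamma: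
  fixes a z :: real
  assumes "a > 0" "z > 0"
  shows "set_integrable lborel {z<..} (\<lambda>u. u powr (a - 1) * exp (- u))"
proof -
  have "(\<lambda>t. t powr (a - 1) / exp t) absolutely_integrable_on {0..}"
    using Gamma_integral_real[OF assms(1)]
    by (intro nonnegative_absolutely_integrable_1) (auto simp: has_integral_integrable)
  then have "(\<lambda>t. t powr (a - 1) / exp t) absolutely_integrable_on {z<..}"
    by (rule set_integrable_subset) (use assms(2) in auto)
  then have "integrable lebesgue (\<lambda>u. indicator {z<..} u *\<^sub>R (u powr (a - 1) / exp u))"
    by (simp add: set_integrable_def)
  then have "integrable lborel (\<lambda>u. indicator {z<..} u *\<^sub>R (u powr (a - 1) / exp u))"
    by (subst (asm) integrable_completion) auto
  then show ?thesis by (simp add: set_integrable_def exp_minus divide_inverse)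
qed

text \<open>The substitution is \<open>u = z * exp (B * l)\<close>.\<close>

lemma nn_integral_exp_mixture:
  fixes s v B :: real
  assumes B: "B > 0" and s: "s \<ge> 0" and v: "v > 0"
  defines "a \<equiv> (B * s + v) / B\<^sup>2" and "z \<equiv> v / B\<^sup>2"
  shows "(\<integral>\<^sup>+l\<in>{0<..}. ennreal (exp (l * s - bernstein_rate B l * v)) \<partial>lborel) =
    ennreal (exp z / B * (Gamma a * reg_upper_gamma a z / z powr a))"
proof -
  define f where "f = (\<lambda>l. exp (l * s - bernstein_rate B l * v))"
  define g where "g = (\<lambda>u. ln (u / z) / B)"
  define g' where "g' = (\<lambda>u::real. 1 / (B * u))"
  define C where "C = exp z / B / z powr a"
  have z: "z > 0" and a: "a > 0" using B s v by (auto simp: z_def a_def intro!: divide_pos_pos add_nonneg_pos)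
  have vz: "v = z * B\<^sup>2" and az: "a = s / B + z"
    using B by (auto simp: z_def a_def power2_eq_square field_simps)
  \<comment> \<open>At \<open>l = g u\<close> the exponent is \<open>a * ln (u / z) - u + z\<close>:
    the term \<open>l * s\<close> contributes \<open>s / B\<close> to the factor of the logarithm
    and the rate contributes \<open>z\<close>.\<close>
  have fg: "f (g u) * g' u = C * (u powr (a - 1) * exp (- u))" if "u > z" for u
  proof -
    have u: "u > 0" using that z by simp
    have "g u * B = ln (u / z)" using B by (simp add: g_def)
    then have "bernstein_rate B (g u) * v = u - z - z * ln (u / z)"
      using B u z unfolding bernstein_rate_def vz by (simp add: field_simps)
    then have "g u * s - bernstein_rate B (g u) * v = a * ln (u / z) - u + z"
      using B by (simp add: g_def az algebra_simps)
    then have "f (g u) = (u / z) powr a * exp (- u) * exp z"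
      using u z by (simp add: f_def powr_def flip: exp_add)
    also have "(u / z) powr a = u powr a / z powr a" using u z by (simp add: powr_divide)
    also have "u powr a = u powr (a - 1) * u" using u by (simp add: powr_diff)
    finally show ?thesis using u B by (simp add: g'_def C_def mult_ac)
  qed
  have int: "set_integrable lborel {z<..} (\<lambda>u. C * (u powr (a - 1) * exp (- u)))"
    using set_integrable_upper_gamma[OF a z] by simp
  have int': "set_integrable lborel (einterval (ereal z) \<infinity>) (\<lambda>u. f (g u) * g' u)"
    using int fg by (subst set_integrable_cong) auto
  have tendsto0: "((ereal \<circ> g \<circ> real_of_ereal) \<longlongrightarrow> 0) (at_right (ereal z))"
  proof -
    have "(g \<longlongrightarrow> g z) (at_right z)"
      unfolding g_def using z B by (intro tendsto_intros) auto
    then have "((\<lambda>x. ereal (g x)) \<longlongrightarrow> ereal (g z)) (at_right z)" by (intro tendsto_intros)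
    moreover have "g z = 0" using z by (simp add: g_def)
    ultimately show ?thesis
      unfolding ereal_tendsto_simps1 by (simp add: o_def zero_ereal_def)
  qed
  have tendsto_top: "((ereal \<circ> g \<circ> real_of_ereal) \<longlongrightarrow> \<infinity>) (at_left \<infinity>)"
  proof -
    have "filterlim (\<lambda>u. u / z) at_top at_top"
      using filterlim_tendsto_pos_mult_at_top[OF tendsto_const[of "1 / z"] _ filterlim_ident] z by simp
    then have "filterlim (\<lambda>u. ln (u / z)) at_top at_top"
      by (rule filterlim_compose[OF ln_at_top])
    from filterlim_tendsto_pos_mult_at_top[OF tendsto_const[of "1 / B"] _ this]
    have "filterlim g at_top at_top" using B by (simp add: g_def)
    then show ?thesis
      unfolding ereal_tendsto_simps1 by (simp add: o_def tendsto_PInfty_eq_at_top)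
  qed
  have deriv: "(g has_real_derivative g' u) (at u)" if "u > z" for u
  proof -
    have "u > 0" using that z by simp
    then show ?thesis unfolding g_def g'_def using z B
      by (auto intro!: derivative_eq_intros simp: field_simps)
  qed
  have isCont: "isCont f (g u)" "isCont g' u" if "u > z" for u
    using that z B unfolding f_def g'_def bernstein_rate_def by (auto intro!: continuous_intros)
  \<comment> \<open>The variable \<open>l\<close> is expressed through \<open>u\<close>, because it
    is the transformed integrand that is known to be integrable; integrability of \<open>f\<close>
    then comes out of the substitution.\<close>
  note substitution = interval_integral_substitution_nonneg[of "ereal z" \<infinity> g g' f 0 \<infinity>]
  have 1: "set_integrable lborel (einterval 0 \<infinity>) f"
    by (rule substitution(1)[OF _ _ _ _ _ _ tendsto0 tendsto_top int'])
      (use deriv isCont z B in \<open>simp_all add: f_def[abs_def] g'_def[abs_def]\<close>)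
  have 2: "(LBINT x=0..\<infinity>. f x) = (LBINT x=ereal z..\<infinity>. f (g x) * g' x)"
    by (rule substitution(2)[OF _ _ _ _ _ _ tendsto0 tendsto_top int'])
      (use deriv isCont z B in \<open>simp_all add: f_def[abs_def] g'_def[abs_def]\<close>)
  have ein: "einterval 0 \<infinity> = {0<..}" by (auto simp: einterval_def zero_ereal_def)
  have "(LBINT x:{0<..}. f x) = (LBINT u:{z<..}. f (g u) * g' u)"
    using 2 ein by (simp add: interval_lebesgue_integral_def)
  also have "\<dots> = (LBINT u:{z<..}. C * (u powr (a - 1) * exp (- u)))"
    using fg by (intro set_lebesgue_integral_cong) auto
  also have "\<dots> = C * (LBINT u:{z<..}. u powr (a - 1) * exp (- u))" by simp
  also have "(LBINT u:{z<..}. u powr (a - 1) * exp (- u)) = Gamma a * reg_upper_gamma a z"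
    by (rule Gamma_reg_upper_gamma[OF a, symmetric])
  finally have eq: "(LBINT x:{0<..}. f x) = C * (Gamma a * reg_upper_gamma a z)" .
  have "(\<integral>\<^sup>+l\<in>{0<..}. ennreal (f l) \<partial>lborel) = (\<integral>\<^sup>+l. ennreal (indicator {0<..} l *\<^sub>R f l) \<partial>lborel)"
    by (intro nn_integral_cong) (auto simp: indicator_def)
  also have "\<dots> = ennreal (LBINT x:{0<..}. f x)"
    unfolding set_lebesgue_integral_def using 1
    by (intro nn_integral_eq_integral) (auto simp: set_integrable_def ein f_def)
  finally show ?thesis unfolding eq by (simp add: f_def C_def)
qed

text \<open>The integrand is strictly positive on \<open>{z<..<z+1}\<close>, so a vanishing integral
  would make that interval a null set.\<close>

lemma Gamma_reg_upper_gamma_pos: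
  fixes a z :: real
  assumes "a > 0" "z > 0"
  shows "Gamma a * reg_upper_gamma a z > 0"
proof -
  define h where "h = (\<lambda>u. indicator {z<..} u *\<^sub>R (u powr (a - 1) * exp (- u)))"
  have int: "integrable lborel h"
    using set_integrable_upper_gamma[OF assms] by (simp add: set_integrable_def h_def)
  have "integral\<^sup>L lborel h \<noteq> 0"
  proof
    assume "integral\<^sup>L lborel h = 0"
    then have "AE u in lborel. h u = 0"
      using int by (subst (asm) integral_nonneg_eq_0_iff_AE) (auto simp: h_def)
    then have "AE u in lborel. u \<notin> {z<..<z+1}"
      by (rule AE_mp) (use assms in \<open>auto simp: h_def intro!: AE_I2\<close>)
    then have "{z<..<z+1} \<in> null_sets lborel"
      by (subst AE_iff_null_sets) auto
    then have "emeasure lborel {z<..<z+1} = 0" by (rule null_setsD1)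
    moreover have "emeasure lborel {z<..<z+1} = 1" by simp
    ultimately show False by (metis zero_neq_one)
  qed
  moreover have "integral\<^sup>L lborel h \<ge> 0" by (auto simp: h_def)
  ultimately have "integral\<^sup>L lborel h > 0" by simp
  then show ?thesis
    unfolding Gamma_reg_upper_gamma[OF assms(1)] by (simp add: set_lebesgue_integral_def h_def)
qed

section \<open>The mixture supermartingale\<close>

lemma markov_split:
  fixes f :: "'a \<Rightarrow> ennreal"
  assumes [measurable]: "f \<in> borel_measurable M" "A \<in> sets M"
  shows "c * emeasure M {\<omega> \<in> A. c \<le> f \<omega>} + (\<integral>\<^sup>+\<omega>\<in>{\<omega> \<in> A. \<not> c \<le> f \<omega>}. f \<omega> \<partial>M) \<le> (\<integral>\<^sup>+\<omega>\<in>A. f \<omega> \<partial>M)"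
proof -
  have A: "A \<subseteq> space M" by (rule sets.sets_into_space) simp
  have eq: "{\<omega> \<in> A. P \<omega>} = {\<omega> \<in> space M. \<omega> \<in> A \<and> P \<omega>}" for P using A by auto
  have [measurable]: "{\<omega> \<in> A. c \<le> f \<omega>} \<in> sets M" "{\<omega> \<in> A. \<not> c \<le> f \<omega>} \<in> sets M"
    unfolding eq by measurable
  have "c * emeasure M {\<omega> \<in> A. c \<le> f \<omega>} + (\<integral>\<^sup>+\<omega>\<in>{\<omega> \<in> A. \<not> c \<le> f \<omega>}. f \<omega> \<partial>M)
      = (\<integral>\<^sup>+\<omega>. c * indicator {\<omega> \<in> A. c \<le> f \<omega>} \<omega> + f \<omega> * indicator {\<omega> \<in> A. \<not> c \<le> f \<omega>} \<omega> \<partial>M)"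
    by (simp add: nn_integral_add nn_integral_cmult_indicator)
  also have "\<dots> \<le> (\<integral>\<^sup>+\<omega>\<in>A. f \<omega> \<partial>M)"
    by (intro nn_integral_mono) (auto simp: indicator_def)
  finally show ?thesis .
qed

text \<open>The supermartingale property is stated through integrals over past events, so values in
  \<open>ennreal\<close> need no conditional expectation and no integrability.\<close>

lemma ville_inequality:
  fixes S :: "nat \<Rightarrow> 'a \<Rightarrow> ennreal"
  assumes sub: "\<And>t. subalgebra M (F t)" and mono: "\<And>s t. s \<le> t \<Longrightarrow> subalgebra (F t) (F s)"
    and meas: "\<And>t. S t \<in> borel_measurable (F t)"
    and super: "\<And>t A. A \<in> sets (F t) \<Longrightarrow> (\<integral>\<^sup>+\<omega>\<in>A. S (Suc t) \<omega> \<partial>M) \<le> (\<integral>\<^sup>+\<omega>\<in>A. S t \<omega> \<partial>M)"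
  shows "c * emeasure M {\<omega> \<in> space M. \<exists>t. c \<le> S t \<omega>} \<le> (\<integral>\<^sup>+\<omega>. S 0 \<omega> \<partial>M)"
proof -
  define H where "H = (\<lambda>n. {\<omega> \<in> space M. \<exists>t\<le>n. c \<le> S t \<omega>})"
  define N where "N = (\<lambda>n. {\<omega> \<in> space M. \<forall>t\<le>n. \<not> c \<le> S t \<omega>})"
  have space: "space (F t) = space M" for t using sub[of t] by (simp add: subalgebra_def)
  have S_M [measurable]: "S t \<in> borel_measurable M" for t
    using measurable_from_subalg[OF sub meas] .
  have [measurable]: "H n \<in> sets M" "N n \<in> sets M" for n by (auto simp: H_def N_def)
  have N_F: "N n \<in> sets (F n)" for n
  proof -
    have [measurable]: "S t \<in> borel_measurable (F n)" if "t \<le> n" for t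
      using measurable_from_subalg[OF mono[OF that] meas] .
    have "N n = {\<omega> \<in> space (F n). \<forall>t\<in>{..n}. \<not> c \<le> S t \<omega>}" by (auto simp: N_def space)
    also have "\<dots> \<in> sets (F n)" by measurable
    finally show ?thesis .
  qed
  \<comment> \<open>The invariant is the maximal inequality for the process stopped on first
    reaching \<open>c\<close>: paths in \<open>H n\<close> are charged \<open>c\<close>, those in
    \<open>N n\<close> still carry their current value. Each step splits \<open>N n\<close> by
    \<open>markov_split\<close> and uses \<open>super\<close> on \<open>N n\<close>, an event of
    \<open>F n\<close>.\<close>
  have "c * emeasure M (H n) + (\<integral>\<^sup>+\<omega>\<in>N n. S n \<omega> \<partial>M) \<le> (\<integral>\<^sup>+\<omega>. S 0 \<omega> \<partial>M)" for n
  proof (induction n)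
    case 0
    have "(\<integral>\<^sup>+\<omega>\<in>space M. S 0 \<omega> \<partial>M) = (\<integral>\<^sup>+\<omega>. S 0 \<omega> \<partial>M)"
      by (intro nn_integral_cong) auto
    then show ?case
      using markov_split[OF S_M sets.top, of c 0] by (simp add: H_def N_def)
  next
    case (Suc n)
    have Suc_sets: "{\<omega> \<in> N n. c \<le> S (Suc n) \<omega>} \<in> sets M"
    proof -
      have "{\<omega> \<in> N n. c \<le> S (Suc n) \<omega>} = {\<omega> \<in> space M. \<omega> \<in> N n \<and> c \<le> S (Suc n) \<omega>}" by (auto simp: N_def)
      then show ?thesis by simp
    qed
    have "H (Suc n) = H n \<union> {\<omega> \<in> N n. c \<le> S (Suc n) \<omega>}" "H n \<inter> {\<omega> \<in> N n. c \<le> S (Suc n) \<omega>} = {}"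
      by (auto simp: H_def N_def le_Suc_eq)
    then have "emeasure M (H (Suc n)) = emeasure M (H n) + emeasure M {\<omega> \<in> N n. c \<le> S (Suc n) \<omega>}"
      using Suc_sets by (simp add: plus_emeasure)
    moreover have "N (Suc n) = {\<omega> \<in> N n. \<not> c \<le> S (Suc n) \<omega>}"
      by (auto simp: N_def le_Suc_eq)
    ultimately have "c * emeasure M (H (Suc n)) + (\<integral>\<^sup>+\<omega>\<in>N (Suc n). S (Suc n) \<omega> \<partial>M)
        = c * emeasure M (H n) + (c * emeasure M {\<omega> \<in> N n. c \<le> S (Suc n) \<omega>} +
          (\<integral>\<^sup>+\<omega>\<in>{\<omega> \<in> N n. \<not> c \<le> S (Suc n) \<omega>}. S (Suc n) \<omega> \<partial>M))"
      by (simp add: distrib_left add.assoc)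
    also have "\<dots> \<le> c * emeasure M (H n) + (\<integral>\<^sup>+\<omega>\<in>N n. S (Suc n) \<omega> \<partial>M)"
      by (intro add_left_mono markov_split) auto
    also have "\<dots> \<le> c * emeasure M (H n) + (\<integral>\<^sup>+\<omega>\<in>N n. S n \<omega> \<partial>M)"
      by (intro add_left_mono super N_F)
    finally show ?case using Suc by (rule order_trans)
  qed
  then have "c * emeasure M (H n) \<le> (\<integral>\<^sup>+\<omega>. S 0 \<omega> \<partial>M)" for n
    by (meson add_increasing2 order_trans order_refl zero_le)
  then have "(SUP n. c * emeasure M (H n)) \<le> (\<integral>\<^sup>+\<omega>. S 0 \<omega> \<partial>M)" by (intro SUP_least)
  moreover have "(SUP n. c * emeasure M (H n)) = c * emeasure M (\<Union>n. H n)"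
  proof -
    have "incseq H" by (auto simp: incseq_def H_def intro: order_trans)
    then show ?thesis by (subst SUP_emeasure_incseq[symmetric]) (auto simp: SUP_mult_left_ennreal)
  qed
  moreover have "(\<Union>n. H n) = {\<omega> \<in> space M. \<exists>t. c \<le> S t \<omega>}" by (auto simp: H_def)
  ultimately show ?thesis by simp
qed

text \<open>Conditioning on \<open>G\<close> turns \<open>e\<close> into 0 and
  \<open>e\<^sup>2\<close> into at most \<open>q\<close>; then
  \<open>1 + h * q \<le> exp (h * q)\<close>. The coefficients \<open>P\<close>, \<open>h\<close>
  and \<open>k\<close> are \<open>G\<close>-measurable and can be pulled out, and the common bound
  \<open>K\<close> supplies integrability.\<close>

lemma (in prob_space) bernstein_conditional_step:
  assumes sub: "subalgebra M G" and A: "A \<in> sets G"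
    and e_meas [measurable]: "e \<in> borel_measurable M" and e_bdd: "\<And>\<omega>. \<omega> \<in> space M \<Longrightarrow> \<bar>e \<omega>\<bar> \<le> B"
    and mean: "AE \<omega> in M. real_cond_exp M G e \<omega> = 0"
    and var: "AE \<omega> in M. cond_var M G e \<omega> \<le> q \<omega>"
    and meas: "P \<in> borel_measurable G" "h \<in> borel_measurable G" "k \<in> borel_measurable G"
    and [measurable]: "L \<in> borel_measurable M" "L' \<in> borel_measurable M"
    and P: "\<And>\<omega>. \<omega> \<in> space M \<Longrightarrow> 0 \<le> P \<omega> \<and> P \<omega> \<le> K"
    and h: "\<And>\<omega>. \<omega> \<in> space M \<Longrightarrow> 0 \<le> h \<omega> \<and> h \<omega> \<le> K"
    and k: "\<And>\<omega>. \<omega> \<in> space M \<Longrightarrow> \<bar>k \<omega>\<bar> \<le> K"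
    and L: "\<And>\<omega>. \<omega> \<in> space M \<Longrightarrow> 0 \<le> L \<omega> \<and> L \<omega> \<le> K"
    and L': "\<And>\<omega>. \<omega> \<in> space M \<Longrightarrow> 0 \<le> L' \<omega> \<and> L' \<omega> \<le> K"
    and upper: "\<And>\<omega>. \<omega> \<in> space M \<Longrightarrow> L' \<omega> \<le> P \<omega> * (1 + h \<omega> * (e \<omega>)\<^sup>2) + k \<omega> * e \<omega>"
    and lower: "\<And>\<omega>. \<omega> \<in> space M \<Longrightarrow> P \<omega> * exp (h \<omega> * q \<omega>) \<le> L \<omega>"
  shows "(\<integral>\<^sup>+\<omega>\<in>A. ennreal (L' \<omega>) \<partial>M) \<le> (\<integral>\<^sup>+\<omega>\<in>A. ennreal (L \<omega>) \<partial>M)"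
proof -
  interpret finite_measure_subalgebra M G
    by unfold_locales (rule sub)
  note [measurable] = meas(1)[THEN measurable_from_subalg[OF sub]] meas(2)[THEN measurable_from_subalg[OF sub]]
    meas(3)[THEN measurable_from_subalg[OF sub]]
  have [measurable]: "A \<in> sets M" using A sub by (auto simp: subalgebra_def)
  \<comment> \<open>The indicator of \<open>A\<close> is absorbed into the
    \<open>G\<close>-measurable factor, so that \<open>real_cond_exp_intg\<close> handles the
    integrals over \<open>A\<close>.\<close>
  define I where "I = (indicator A :: 'a \<Rightarrow> real)"
  have [measurable]: "I \<in> borel_measurable M" by (simp add: I_def)
  have I_G: "I \<in> borel_measurable G" using A by (simp add: I_def)
  have I: "0 \<le> I \<omega>" "I \<omega> \<le> 1" "\<bar>I \<omega>\<bar> \<le> 1" for \<omega> by (auto simp: I_def indicator_def)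
  have intI: "integrable M (\<lambda>\<omega>. I \<omega> * f \<omega>)"
    if "f \<in> borel_measurable M" "\<And>\<omega>. \<omega> \<in> space M \<Longrightarrow> \<bar>f \<omega>\<bar> \<le> b" for f b
  proof (rule integrable_const_bound[of _ b])
    show "AE \<omega> in M. norm (I \<omega> * f \<omega>) \<le> b"
      using that(2) by (intro AE_I2) (auto simp: I_def indicator_def abs_mult intro: order_trans[OF abs_ge_zero])
  qed (use that(1) in simp)
  have e2: "(e \<omega>)\<^sup>2 \<le> B\<^sup>2" if "\<omega> \<in> space M" for \<omega>
    using e_bdd[OF that] by (metis abs_ge_zero power2_abs power_mono)
  have Phe: "integrable M (\<lambda>\<omega>. (I \<omega> * (P \<omega> * h \<omega>)) * (e \<omega>)\<^sup>2)"
  proof -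
    have "integrable M (\<lambda>\<omega>. I \<omega> * (P \<omega> * h \<omega> * (e \<omega>)\<^sup>2))"
    proof (rule intI)
      fix \<omega> assume \<omega>: "\<omega> \<in> space M"
      have "P \<omega> * h \<omega> * (e \<omega>)\<^sup>2 \<le> K * K * B\<^sup>2"
        using P[OF \<omega>] h[OF \<omega>] e2[OF \<omega>] by (intro mult_mono) auto
      then show "\<bar>P \<omega> * h \<omega> * (e \<omega>)\<^sup>2\<bar> \<le> K * K * B\<^sup>2" using P[OF \<omega>] h[OF \<omega>] by simp
    qed simp
    then show ?thesis by (simp add: mult.assoc)
  qed
  have ke: "integrable M (\<lambda>\<omega>. (I \<omega> * k \<omega>) * e \<omega>)"
  proof -
    have "integrable M (\<lambda>\<omega>. I \<omega> * (k \<omega> * e \<omega>))"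
    proof (rule intI)
      fix \<omega> assume \<omega>: "\<omega> \<in> space M"
      show "\<bar>k \<omega> * e \<omega>\<bar> \<le> K * B"
        unfolding abs_mult using k[OF \<omega>] e_bdd[OF \<omega>] by (intro mult_mono) auto
    qed simp
    then show ?thesis by (simp add: mult.assoc)
  qed
  have P_int: "integrable M (\<lambda>\<omega>. I \<omega> * P \<omega>)" by (rule intI[of _ K]) (use P in auto)
  have L_int: "integrable M (\<lambda>\<omega>. I \<omega> * L \<omega>)" by (rule intI[of _ K]) (use L in auto)
  have L'_int: "integrable M (\<lambda>\<omega>. I \<omega> * L' \<omega>)" by (rule intI[of _ K]) (use L' in auto)
  have Phe_G: "(\<lambda>\<omega>. I \<omega> * (P \<omega> * h \<omega>)) \<in> borel_measurable G" and ke_G: "(\<lambda>\<omega>. I \<omega> * k \<omega>) \<in> borel_measurable G"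
    using I_G meas by auto
  define v where "v = real_cond_exp M G (\<lambda>\<omega>. (e \<omega>)\<^sup>2)"
  note Phe' = real_cond_exp_intg[OF Phe Phe_G, folded v_def, simplified]
  note ke' = real_cond_exp_intg[OF ke ke_G, simplified]
  have ke0: "(\<integral>\<omega>. (I \<omega> * k \<omega>) * e \<omega> \<partial>M) = 0"
    unfolding ke'(2)[symmetric] by (rule integral_eq_zero_AE) (use mean in auto)
  \<comment> \<open>The conditional mean vanishes almost everywhere, so \<open>cond_var\<close>
    agrees with the conditional second moment \<open>v\<close>.\<close>
  have v_le: "AE \<omega> in M. v \<omega> \<le> q \<omega>"
  proof -
    have "AE \<omega> in M. (e \<omega> - real_cond_exp M G e \<omega>)\<^sup>2 = (e \<omega>)\<^sup>2" using mean by auto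
    then have "AE \<omega> in M. cond_var M G e \<omega> = v \<omega>"
      unfolding cond_var_def v_def by (rule real_cond_exp_cong) auto
    with var show ?thesis by auto
  qed
  have "(\<integral>\<omega>. I \<omega> * L' \<omega> \<partial>M) \<le> (\<integral>\<omega>. I \<omega> * P \<omega> + (I \<omega> * (P \<omega> * h \<omega>)) * (e \<omega>)\<^sup>2 + (I \<omega> * k \<omega>) * e \<omega> \<partial>M)"
  proof (rule integral_mono)
    fix \<omega> assume "\<omega> \<in> space M"
    from mult_left_mono[OF upper[OF this] I(1)]
    show "I \<omega> * L' \<omega> \<le> I \<omega> * P \<omega> + (I \<omega> * (P \<omega> * h \<omega>)) * (e \<omega>)\<^sup>2 + (I \<omega> * k \<omega>) * e \<omega>"
      by (simp add: algebra_simps)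
  qed (intro L'_int Bochner_Integration.integrable_add P_int Phe ke)+
  also have "\<dots> = (\<integral>\<omega>. I \<omega> * P \<omega> + (I \<omega> * (P \<omega> * h \<omega>)) * v \<omega> \<partial>M)"
    using P_int Phe ke Phe' ke0 by simp
  also have "\<dots> \<le> (\<integral>\<omega>. I \<omega> * L \<omega> \<partial>M)"
  proof (rule integral_mono_AE)
    show "AE \<omega> in M. I \<omega> * P \<omega> + (I \<omega> * (P \<omega> * h \<omega>)) * v \<omega> \<le> I \<omega> * L \<omega>"
      using v_le AE_space
    proof eventually_elim
      case (elim \<omega>)
      have "P \<omega> * (1 + h \<omega> * v \<omega>) \<le> P \<omega> * exp (h \<omega> * q \<omega>)"
      proof (rule mult_left_mono)
        have "1 + h \<omega> * v \<omega> \<le> 1 + h \<omega> * q \<omega>" using elim h[of \<omega>] by (simp add: mult_left_mono)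
        also have "\<dots> \<le> exp (h \<omega> * q \<omega>)" by (rule exp_ge_add_one_self)
        finally show "1 + h \<omega> * v \<omega> \<le> exp (h \<omega> * q \<omega>)" .
      qed (use P elim in auto)
      also have "\<dots> \<le> L \<omega>" using elim by (intro lower)
      finally have "I \<omega> * (P \<omega> * (1 + h \<omega> * v \<omega>)) \<le> I \<omega> * L \<omega>" using I(1) by (rule mult_left_mono)
      then show ?case by (simp add: algebra_simps)
    qed
  qed (intro L_int Bochner_Integration.integrable_add P_int Phe')+
  finally have le: "(\<integral>\<omega>. I \<omega> * L' \<omega> \<partial>M) \<le> (\<integral>\<omega>. I \<omega> * L \<omega> \<partial>M)" .
  have conv: "(\<integral>\<^sup>+\<omega>\<in>A. ennreal (f \<omega>) \<partial>M) = ennreal (\<integral>\<omega>. I \<omega> * f \<omega> \<partial>M)"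
    if "integrable M (\<lambda>\<omega>. I \<omega> * f \<omega>)" "\<And>\<omega>. \<omega> \<in> space M \<Longrightarrow> 0 \<le> f \<omega>" for f
  proof -
    have "(\<integral>\<^sup>+\<omega>\<in>A. ennreal (f \<omega>) \<partial>M) = (\<integral>\<^sup>+\<omega>. ennreal (I \<omega> * f \<omega>) \<partial>M)"
      by (intro nn_integral_cong) (auto simp: I_def indicator_def)
    also have "\<dots> = ennreal (\<integral>\<omega>. I \<omega> * f \<omega> \<partial>M)"
      using that I by (intro nn_integral_eq_integral) auto
    finally show ?thesis .
  qed
  show ?thesis
    using le L L' by (simp add: conv[OF L_int] conv[OF L'_int] ennreal_leI)
qed

lemma borel_measurable_cosh [measurable]: "(cosh :: real \<Rightarrow> real) \<in> borel_measurable borel"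
  by (intro borel_measurable_continuous_onI continuous_intros)

lemma borel_measurable_sinh [measurable]: "(sinh :: real \<Rightarrow> real) \<in> borel_measurable borel"
  by (intro borel_measurable_continuous_onI continuous_intros)

section \<open>The self-normalised process: measurability and one-step decomposition\<close>

locale self_normalized = prob_space M
  for M :: "'a measure"
    and F :: "nat \<Rightarrow> 'a measure"
    and X :: "nat \<Rightarrow> 'a \<Rightarrow> 'h::{real_inner, complete_space, second_countable_topology}"
    and \<epsilon> \<sigma> :: "nat \<Rightarrow> 'a \<Rightarrow> real"
    and B \<rho> :: real +
  assumes filt_sub: "\<And>t. subalgebra M (F t)"
    and filt_mono: "\<And>s t. s \<le> t \<Longrightarrow> subalgebra (F t) (F s)"
    and X_meas: "\<And>t. t \<ge> 1 \<Longrightarrow> X t \<in> borel_measurable (F (t - 1))"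
    and eps_meas: "\<And>t. t \<ge> 1 \<Longrightarrow> \<epsilon> t \<in> borel_measurable (F t)"
    and eps_mean: "\<And>t. t \<ge> 1 \<Longrightarrow> AE \<omega> in M. real_cond_exp M (F (t - 1)) (\<epsilon> t) \<omega> = 0"
    and B_pos: "B > 0"
    and eps_bdd: "\<And>t \<omega>. t \<ge> 1 \<Longrightarrow> \<omega> \<in> space M \<Longrightarrow> \<bar>\<epsilon> t \<omega>\<bar> \<le> B"
    and sigma_meas: "\<And>t. t \<ge> 1 \<Longrightarrow> \<sigma> t \<in> borel_measurable (F (t - 1))"
    and eps_var: "\<And>t. t \<ge> 1 \<Longrightarrow> AE \<omega> in M. cond_var M (F (t - 1)) (\<epsilon> t) \<omega> \<le> (\<sigma> t \<omega>)\<^sup>2"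
    and rho_pos: "\<rho> > 0"
begin

definition msum :: "nat \<Rightarrow> 'a \<Rightarrow> 'h" where
  "msum t \<omega> = (\<Sum>i\<in>{1..t}. \<epsilon> i \<omega> *\<^sub>R X i \<omega>)"

definition Ri :: "nat \<Rightarrow> 'a \<Rightarrow> 'h \<Rightarrow> 'h" where
  "Ri t \<omega> = reg_inv \<rho> (\<lambda>i. X i \<omega>) t"

text \<open>These are \<open>s\<^sub>t\<close> and \<open>\<nu>\<^sub>t\<close>, expressed through the inverse operator instead of its square root:
  in this form their measurability is immediate.\<close>

definition snorm :: "nat \<Rightarrow> 'a \<Rightarrow> real" where
  "snorm t \<omega> = sqrt (msum t \<omega> \<bullet> Ri t \<omega> (msum t \<omega>))"

definition nu :: "nat \<Rightarrow> 'a \<Rightarrow> real" where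
  "nu t \<omega> = (\<Sum>i\<in>{1..t}. (\<sigma> i \<omega>)\<^sup>2 * (X i \<omega> \<bullet> Ri i \<omega> (X i \<omega>)))"

lemma X_meas': "1 \<le> i \<Longrightarrow> i \<le> Suc t \<Longrightarrow> X i \<in> borel_measurable (F t)"
  by (rule measurable_from_subalg[OF filt_mono X_meas]) auto

lemma sigma_meas': "1 \<le> i \<Longrightarrow> i \<le> Suc t \<Longrightarrow> \<sigma> i \<in> borel_measurable (F t)"
  by (rule measurable_from_subalg[OF filt_mono sigma_meas]) auto

lemma eps_meas': "1 \<le> i \<Longrightarrow> i \<le> t \<Longrightarrow> \<epsilon> i \<in> borel_measurable (F t)"
  by (rule measurable_from_subalg[OF filt_mono eps_meas]) auto

text \<open>The recursion uses only inner products and scalings. It applies the previous inverse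
  both to \<open>f\<close> and to the new \<open>X\<close>, hence the induction over arbitrary
  \<open>f\<close>. The index may reach \<open>Suc t\<close> because \<open>X\<close> is
  predictable.\<close>

lemma Ri_measurable:
  assumes "f \<in> borel_measurable (F t)" "n \<le> Suc t"
  shows "(\<lambda>\<omega>. Ri n \<omega> (f \<omega>)) \<in> borel_measurable (F t)"
  using assms
proof (induction n arbitrary: f)
  case 0
  then show ?case by (simp add: Ri_def)
next
  case (Suc n)
  have X: "X (Suc n) \<in> borel_measurable (F t)" using Suc.prems by (intro X_meas') auto
  note [measurable] = X Suc.prems(1)
  have "n \<le> Suc t" using Suc.prems by simp
  note [measurable] = Suc.IH[OF X this] Suc.IH[OF Suc.prems(1) this]
  show ?case unfolding Ri_def reg_inv.simps unfolding Ri_def[symmetric] by measurable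
qed

lemma msum_measurable [measurable]: "msum t \<in> borel_measurable (F t)"
  unfolding msum_def[abs_def]
  by (intro borel_measurable_sum borel_measurable_scaleR eps_meas' X_meas') auto

lemma snorm_measurable: "snorm t \<in> borel_measurable (F t)"
  unfolding snorm_def[abs_def]
  by (intro borel_measurable_sqrt[THEN measurable_compose[rotated]] borel_measurable_inner msum_measurable Ri_measurable) auto

lemma nu_measurable:
  assumes "n \<le> Suc t"
  shows "nu n \<in> borel_measurable (F t)"
  unfolding nu_def[abs_def] using assms
  by (intro borel_measurable_sum borel_measurable_times borel_measurable_power borel_measurable_inner
      sigma_meas' X_meas' Ri_measurable) auto

lemma nu_nonneg: "0 \<le> nu t \<omega>"
  unfolding nu_def Ri_def using rho_pos by (intro sum_nonneg mult_nonneg_nonneg inner_reg_inv_nonneg) auto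

lemma nu_Suc: "nu (Suc t) \<omega> = nu t \<omega> + (\<sigma> (Suc t) \<omega>)\<^sup>2 * (X (Suc t) \<omega> \<bullet> Ri (Suc t) \<omega> (X (Suc t) \<omega>))"
  by (simp add: nu_def)

text \<open>The norm of the predictable part of the vector whose norm is \<open>snorm (Suc t)\<close>.\<close>

definition pnorm :: "nat \<Rightarrow> 'a \<Rightarrow> real" where
  "pnorm t \<omega> = sqrt (msum t \<omega> \<bullet> Ri (Suc t) \<omega> (msum t \<omega>))"

lemma pnorm_measurable: "pnorm t \<in> borel_measurable (F t)"
  unfolding pnorm_def[abs_def]
  by (intro borel_measurable_sqrt[THEN measurable_compose[rotated]] borel_measurable_inner msum_measurable Ri_measurable) auto

lemma norm_inv_sqrt:
  "norm (inv_sqrt_op (reg_op \<rho> (\<lambda>i. X i \<omega>) t) v) = sqrt (v \<bullet> Ri t \<omega> v)"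
  by (simp add: norm_eq_sqrt_inner inv_sqrt_reg_op[OF rho_pos] Ri_def)

text \<open>Take \<open>y\<close> and \<open>g\<close> to be the images of \<open>msum t\<close> and
  of \<open>X (Suc t)\<close> under the square root at time \<open>Suc t\<close>. Only their norms
  and inner product matter later, and these are expressions in \<open>Ri\<close>, so measurability
  of the square root never arises.\<close>

lemma snorm_Suc:
  obtains y g :: 'h where "snorm (Suc t) \<omega> = norm (y + \<epsilon> (Suc t) \<omega> *\<^sub>R g)" "norm y = pnorm t \<omega>"
    "(norm g)\<^sup>2 = X (Suc t) \<omega> \<bullet> Ri (Suc t) \<omega> (X (Suc t) \<omega>)" "norm g \<le> 1"
    "y \<bullet> g = msum t \<omega> \<bullet> Ri (Suc t) \<omega> (X (Suc t) \<omega>)"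
proof -
  define W where "W = inv_sqrt_op (reg_op \<rho> (\<lambda>i. X i \<omega>) (Suc t))"
  have lin: "linear W" and inner: "\<And>v w. W v \<bullet> W w = v \<bullet> Ri (Suc t) \<omega> w"
    unfolding W_def Ri_def using inv_sqrt_reg_op[OF rho_pos] by blast+
  have norm: "norm (W v) = sqrt (v \<bullet> Ri (Suc t) \<omega> v)" for v
    unfolding W_def by (rule norm_inv_sqrt)
  have "msum (Suc t) \<omega> = msum t \<omega> + \<epsilon> (Suc t) \<omega> *\<^sub>R X (Suc t) \<omega>" by (simp add: msum_def)
  then have "snorm (Suc t) \<omega> = norm (W (msum t \<omega>) + \<epsilon> (Suc t) \<omega> *\<^sub>R W (X (Suc t) \<omega>))"
    using norm[of "msum (Suc t) \<omega>"] by (simp add: snorm_def linear_add[OF lin] linear_scale[OF lin])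
  moreover have "norm (W (X (Suc t) \<omega>)) \<le> 1"
    unfolding norm using inner_reg_inv_Suc_le_1[OF rho_pos, of "\<lambda>i. X i \<omega>" t] by (simp add: Ri_def)
  ultimately show thesis
    by (intro that[of "W (msum t \<omega>)" "W (X (Suc t) \<omega>)"]) (auto simp: pnorm_def norm[of "msum t \<omega>"] inner power2_norm_eq_inner)
qed

lemma pnorm_nonneg: "0 \<le> pnorm t \<omega>"
  by (metis norm_ge_zero snorm_Suc)

lemma pnorm_le: "pnorm t \<omega> \<le> snorm t \<omega>"
  unfolding pnorm_def snorm_def Ri_def by (intro real_sqrt_le_mono inner_reg_inv_Suc_le rho_pos)

lemma snorm_nonneg: "0 \<le> snorm t \<omega>"
  using pnorm_nonneg pnorm_le by (rule order_trans)

text \<open>Each step adds a vector of norm at most \<open>B\<close>, while passing to the larger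
  operator cannot increase the norm. This crude bound makes the cosh processes bounded at each fixed
  time.\<close>

lemma snorm_le:
  assumes "\<omega> \<in> space M"
  shows "snorm t \<omega> \<le> B * real t"
proof (induction t)
  case 0
  then show ?case by (simp add: snorm_def msum_def)
next
  case (Suc t)
  obtain y g :: 'h where yg: "snorm (Suc t) \<omega> = norm (y + \<epsilon> (Suc t) \<omega> *\<^sub>R g)" "norm y = pnorm t \<omega>" "norm g \<le> 1"
    by (rule snorm_Suc[of t \<omega>])
  have "\<bar>\<epsilon> (Suc t) \<omega>\<bar> * norm g \<le> B * 1"
    using yg(3) eps_bdd[of "Suc t" \<omega>] assms by (intro mult_mono) auto
  then have "snorm (Suc t) \<omega> \<le> pnorm t \<omega> + B"
    unfolding yg(1) using norm_triangle_ineq[of y "\<epsilon> (Suc t) \<omega> *\<^sub>R g"] yg(2) by simp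
  then show ?case using pnorm_le[of t \<omega>] Suc by (simp add: algebra_simps)
qed

section \<open>The supermartingale for a fixed parameter\<close>

definition cosh_process :: "real \<Rightarrow> nat \<Rightarrow> 'a \<Rightarrow> real" where
  "cosh_process l t \<omega> = cosh (l * snorm t \<omega>) * exp (- bernstein_rate B l * nu t \<omega>)"

lemma cosh_process_supermartingale:
  assumes A: "A \<in> sets (F t)" and l: "0 \<le> l"
  shows "(\<integral>\<^sup>+\<omega>\<in>A. ennreal (cosh_process l (Suc t) \<omega>) \<partial>M) \<le> (\<integral>\<^sup>+\<omega>\<in>A. ennreal (cosh_process l t \<omega>) \<partial>M)"
proof -
  define c where "c = (\<lambda>\<omega>. msum t \<omega> \<bullet> Ri (Suc t) \<omega> (X (Suc t) \<omega>))"
  define b where "b = (\<lambda>\<omega>. X (Suc t) \<omega> \<bullet> Ri (Suc t) \<omega> (X (Suc t) \<omega>))"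
  define d where "d = (\<lambda>\<omega>. exp (- bernstein_rate B l * nu (Suc t) \<omega>))"
  define P where "P = (\<lambda>\<omega>. d \<omega> * cosh (l * pnorm t \<omega>))"
  define h where "h = (\<lambda>\<omega>. bernstein_rate B l * b \<omega>)"
  define k where "k = (\<lambda>\<omega>. d \<omega> * (l * sinh (l * pnorm t \<omega>) * (c \<omega> / pnorm t \<omega>)))"
  define K0 where "K0 = cosh (l * (B * real (Suc t)))"
  \<comment> \<open>\<open>K0\<close> bounds every cosh that occurs up to time \<open>Suc t\<close>;
    \<open>K\<close> then dominates \<open>P\<close>, \<open>h\<close>, \<open>k\<close> and both
    values of the process simultaneously.\<close>
  define K where "K = (1 + l + bernstein_rate B l) * K0"
  have rate: "0 \<le> bernstein_rate B l" by (rule bernstein_rate_nonneg)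
  have K0: "1 \<le> K0" unfolding K0_def by (rule cosh_real_ge_1)
  have K_ge: "K0 \<le> K" "l * K0 \<le> K" "bernstein_rate B l \<le> K"
  proof -
    show "K0 \<le> K" "l * K0 \<le> K" using rate l K0 by (auto simp: K_def algebra_simps)
    have "bernstein_rate B l \<le> bernstein_rate B l * K0" using mult_left_mono[OF K0 rate] by simp
    also have "\<dots> \<le> K" using rate l K0 by (auto simp: K_def algebra_simps)
    finally show "bernstein_rate B l \<le> K" .
  qed
  have d: "0 < d \<omega>" "d \<omega> \<le> 1" for \<omega>
    using rate nu_nonneg[of "Suc t" \<omega>] by (auto simp: d_def)
  have bound: "cosh (l * u) \<le> K0" if "0 \<le> u" "u \<le> B * real (Suc t)" for u
    unfolding K0_def using that l B_pos by (subst cosh_real_nonneg_le_iff) (auto intro!: mult_left_mono mult_nonneg_nonneg)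
  have pn_le: "pnorm t \<omega> \<le> B * real (Suc t)" if "\<omega> \<in> space M" for \<omega>
    using pnorm_le[of t \<omega>] snorm_le[OF that, of t] B_pos by (simp add: algebra_simps)
  have cp: "0 \<le> cosh_process l n \<omega> \<and> cosh_process l n \<omega> \<le> K" if "\<omega> \<in> space M" "n \<le> Suc t" for n \<omega>
  proof -
    have "snorm n \<omega> \<le> B * real (Suc t)"
      using snorm_le[OF that(1), of n] that(2) B_pos by (auto intro!: mult_left_mono elim!: order_trans)
    then have "cosh (l * snorm n \<omega>) * exp (- bernstein_rate B l * nu n \<omega>) \<le> K0 * 1"
      using rate nu_nonneg[of n \<omega>] snorm_nonneg[of n \<omega>] K0 by (intro mult_mono bound) auto
    then show ?thesis using K_ge(1) by (simp add: cosh_process_def)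
  qed
  have meas_X: "X (Suc t) \<in> borel_measurable (F t)" by (rule X_meas') auto
  have [measurable]: "c \<in> borel_measurable (F t)" "b \<in> borel_measurable (F t)" "nu (Suc t) \<in> borel_measurable (F t)"
    "pnorm t \<in> borel_measurable (F t)"
    unfolding c_def b_def
    by (intro borel_measurable_inner msum_measurable meas_X Ri_measurable nu_measurable pnorm_measurable; simp)+
  have P_meas: "P \<in> borel_measurable (F t)" unfolding P_def d_def by measurable
  have h_meas: "h \<in> borel_measurable (F t)" unfolding h_def by measurable
  have k_meas: "k \<in> borel_measurable (F t)" unfolding k_def d_def by measurable
  have cp_meas: "cosh_process l n \<in> borel_measurable M" for n
  proof -
    note [measurable] = measurable_from_subalg[OF filt_sub snorm_measurable[of n]]
      measurable_from_subalg[OF filt_sub nu_measurable[of n n]]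
    show ?thesis unfolding cosh_process_def[abs_def] by measurable
  qed
  show ?thesis
  proof (rule bernstein_conditional_step[where e="\<epsilon> (Suc t)" and q="\<lambda>\<omega>. (\<sigma> (Suc t) \<omega>)\<^sup>2" and P=P and h=h and k=k and K=K and B=B,
        OF filt_sub A _ _ _ _ P_meas h_meas k_meas cp_meas cp_meas])
    show "\<epsilon> (Suc t) \<in> borel_measurable M"
      by (rule measurable_from_subalg[OF filt_sub eps_meas]) simp
    show "AE \<omega> in M. real_cond_exp M (F t) (\<epsilon> (Suc t)) \<omega> = 0" using eps_mean[of "Suc t"] by simp
    show "AE \<omega> in M. cond_var M (F t) (\<epsilon> (Suc t)) \<omega> \<le> (\<sigma> (Suc t) \<omega>)\<^sup>2" using eps_var[of "Suc t"] by simp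
    fix \<omega> assume \<omega>: "\<omega> \<in> space M"
    obtain y g :: 'h where yg: "snorm (Suc t) \<omega> = norm (y + \<epsilon> (Suc t) \<omega> *\<^sub>R g)" "norm y = pnorm t \<omega>"
      "(norm g)\<^sup>2 = b \<omega>" "norm g \<le> 1" "y \<bullet> g = c \<omega>"
      unfolding b_def c_def by (rule snorm_Suc[of t \<omega>])
    show eps: "\<bar>\<epsilon> (Suc t) \<omega>\<bar> \<le> B" using eps_bdd \<omega> by simp
    show "0 \<le> cosh_process l t \<omega> \<and> cosh_process l t \<omega> \<le> K"
      "0 \<le> cosh_process l (Suc t) \<omega> \<and> cosh_process l (Suc t) \<omega> \<le> K"
      using cp \<omega> by auto
    have cosh_le: "cosh (l * pnorm t \<omega>) \<le> K0" using pnorm_nonneg pn_le[OF \<omega>] by (rule bound)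
    have "P \<omega> \<le> 1 * K0" unfolding P_def using d[of \<omega>] cosh_le by (intro mult_mono) auto
    then show "0 \<le> P \<omega> \<and> P \<omega> \<le> K" using K_ge(1) d[of \<omega>] by (simp add: P_def)
    have "0 \<le> b \<omega>" "b \<omega> \<le> 1" using yg(3,4) by (auto simp: power_le_one simp flip: yg(3))
    then show "0 \<le> h \<omega> \<and> h \<omega> \<le> K"
      using rate mult_left_mono[of "b \<omega>" 1 "bernstein_rate B l"] K_ge(3) by (simp add: h_def)
    show "\<bar>k \<omega>\<bar> \<le> K"
    proof -
      have "\<bar>c \<omega>\<bar> \<le> pnorm t \<omega> * 1"
        using Cauchy_Schwarz_ineq2[of y g] mult_left_mono[OF yg(4) norm_ge_zero[of y]] yg(2,5) by simp
      \<comment> \<open>If \<open>pnorm t \<omega> = 0\<close> the quotient is 0 by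
        convention.\<close>
      then have c: "\<bar>c \<omega> / pnorm t \<omega>\<bar> \<le> 1"
        using pnorm_nonneg[of t \<omega>] by (auto simp: abs_divide divide_le_eq_1)
      have "sinh (l * pnorm t \<omega>) \<le> K0" using sinh_le_cosh_real[of "l * pnorm t \<omega>"] cosh_le by linarith
      moreover have "0 \<le> sinh (l * pnorm t \<omega>)" using l pnorm_nonneg[of t \<omega>] by simp
      ultimately have "d \<omega> * (l * sinh (l * pnorm t \<omega>) * \<bar>c \<omega> / pnorm t \<omega>\<bar>) \<le> 1 * (l * K0 * 1)"
        using d[of \<omega>] l c K0 by (intro mult_mono) auto
      moreover have "\<bar>k \<omega>\<bar> = d \<omega> * (l * sinh (l * pnorm t \<omega>) * \<bar>c \<omega> / pnorm t \<omega>\<bar>)"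
        using d[of \<omega>] l \<open>0 \<le> sinh (l * pnorm t \<omega>)\<close> by (simp add: k_def abs_mult)
      ultimately show ?thesis using K_ge(2) by simp
    qed
    show "cosh_process l (Suc t) \<omega> \<le> P \<omega> * (1 + h \<omega> * (\<epsilon> (Suc t) \<omega>)\<^sup>2) + k \<omega> * \<epsilon> (Suc t) \<omega>"
    proof -
      have "cosh (l * snorm (Suc t) \<omega>) \<le> cosh (l * pnorm t \<omega>) * (1 + h \<omega> * (\<epsilon> (Suc t) \<omega>)\<^sup>2) +
          l * sinh (l * pnorm t \<omega>) * (c \<omega> / pnorm t \<omega>) * \<epsilon> (Suc t) \<omega>"
        using cosh_norm_step[OF B_pos l eps yg(4), of y] unfolding yg h_def .
      from mult_left_mono[OF this less_imp_le[OF d(1)]] show ?thesis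
        by (simp add: cosh_process_def P_def k_def d_def algebra_simps)
    qed
    \<comment> \<open>The exponential cancels the last increment of \<open>nu\<close>, which
      \<open>d\<close> already contains because that increment is known at time \<open>t\<close>.
      The only loss is replacing \<open>pnorm\<close> by the larger \<open>snorm\<close>.\<close>
    show "P \<omega> * exp (h \<omega> * (\<sigma> (Suc t) \<omega>)\<^sup>2) \<le> cosh_process l t \<omega>"
    proof -
      have "d \<omega> * exp (h \<omega> * (\<sigma> (Suc t) \<omega>)\<^sup>2) = exp (- bernstein_rate B l * nu t \<omega>)"
        unfolding d_def h_def exp_add[symmetric] nu_Suc b_def by (simp add: algebra_simps)
      moreover have "cosh (l * pnorm t \<omega>) \<le> cosh (l * snorm t \<omega>)"
        using l pnorm_nonneg[of t \<omega>] snorm_nonneg[of t \<omega>] pnorm_le[of t \<omega>]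
        by (subst cosh_real_nonneg_le_iff) (auto intro!: mult_left_mono mult_nonneg_nonneg)
      then have "cosh (l * pnorm t \<omega>) * exp (- bernstein_rate B l * nu t \<omega>) \<le> cosh_process l t \<omega>"
        unfolding cosh_process_def by (rule mult_right_mono) simp
      ultimately show ?thesis
        by (metis P_def mult.assoc mult.commute)
    qed
  qed
qed

section \<open>Mixing over the parameter and the final bound\<close>

definition mixture :: "real \<Rightarrow> nat \<Rightarrow> 'a \<Rightarrow> ennreal" where
  "mixture \<theta> t \<omega> = (\<integral>\<^sup>+l\<in>{0<..}. ennreal (exp (- bernstein_rate B l * \<theta>)) * ennreal (cosh_process l t \<omega>) \<partial>lborel)"

text \<open>The choice \<open>N = F t\<close> serves adaptedness of the mixture, the choice
  \<open>N = M\<close> serves Tonelli's theorem.\<close>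

lemma cosh_process_measurable_pair:
  assumes "subalgebra N (F t)"
  shows "(\<lambda>(l, \<omega>). cosh_process l t \<omega>) \<in> borel_measurable (lborel \<Otimes>\<^sub>M N)"
proof -
  note [measurable] = measurable_from_subalg[OF assms snorm_measurable]
  have [measurable]: "nu t \<in> borel_measurable N" by (rule measurable_from_subalg[OF assms nu_measurable]) simp
  show ?thesis unfolding cosh_process_def[abs_def] by measurable
qed

lemma mixture_measurable: "mixture \<theta> t \<in> borel_measurable (F t)"
proof -
  have "subalgebra (F t) (F t)" by (simp add: subalgebra_def)
  note [measurable] = cosh_process_measurable_pair[OF this]
  have "(\<lambda>\<omega>. \<integral>\<^sup>+l. ennreal (exp (- bernstein_rate B l * \<theta>)) * ennreal (cosh_process l t \<omega>) * indicator {0<..} l \<partial>lborel)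
      \<in> borel_measurable (F t)"
    by measurable
  then show ?thesis by (simp add: mixture_def[abs_def])
qed

text \<open>Tonelli moves the integral over \<open>l\<close> outside; inside, the inequality holds
  for each positive \<open>l\<close> and the weights are nonnegative.\<close>

lemma mixture_supermartingale:
  assumes A: "A \<in> sets (F t)"
  shows "(\<integral>\<^sup>+\<omega>\<in>A. mixture \<theta> (Suc t) \<omega> \<partial>M) \<le> (\<integral>\<^sup>+\<omega>\<in>A. mixture \<theta> t \<omega> \<partial>M)"
proof -
  interpret P: pair_sigma_finite lborel M ..
  have [measurable]: "A \<in> sets M" using A filt_sub[of t] by (auto simp: subalgebra_def)
  define w where "w = (\<lambda>l. ennreal (exp (- bernstein_rate B l * \<theta>)) * indicator {0<..} l)"
  have [measurable]: "w \<in> borel_measurable borel" unfolding w_def by measurable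
  have swap: "(\<integral>\<^sup>+\<omega>\<in>A. mixture \<theta> n \<omega> \<partial>M) = (\<integral>\<^sup>+l. w l * (\<integral>\<^sup>+\<omega>\<in>A. ennreal (cosh_process l n \<omega>) \<partial>M) \<partial>lborel)" for n
  proof -
    note [measurable] = cosh_process_measurable_pair[OF filt_sub[of n]]
    have "(\<integral>\<^sup>+\<omega>\<in>A. mixture \<theta> n \<omega> \<partial>M) =
        (\<integral>\<^sup>+\<omega>. (\<integral>\<^sup>+l. w l * (ennreal (cosh_process l n \<omega>) * indicator A \<omega>) \<partial>lborel) \<partial>M)"
    proof (rule nn_integral_cong)
      fix \<omega> assume [simp]: "\<omega> \<in> space M"
      have "mixture \<theta> n \<omega> * indicator A \<omega> = (\<integral>\<^sup>+l. w l * ennreal (cosh_process l n \<omega>) * indicator A \<omega> \<partial>lborel)"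
        by (subst nn_integral_multc) (auto simp: mixture_def w_def mult_ac intro!: arg_cong2[where f="(*)"] nn_integral_cong)
      then show "mixture \<theta> n \<omega> * indicator A \<omega> = (\<integral>\<^sup>+l. w l * (ennreal (cosh_process l n \<omega>) * indicator A \<omega>) \<partial>lborel)"
        by (simp add: mult.assoc)
    qed
    also have "\<dots> = (\<integral>\<^sup>+l. (\<integral>\<^sup>+\<omega>. w l * (ennreal (cosh_process l n \<omega>) * indicator A \<omega>) \<partial>M) \<partial>lborel)"
      by (rule P.Fubini') measurable
    also have "\<dots> = (\<integral>\<^sup>+l. w l * (\<integral>\<^sup>+\<omega>\<in>A. ennreal (cosh_process l n \<omega>) \<partial>M) \<partial>lborel)"
      by (intro nn_integral_cong nn_integral_cmult) measurable
    finally show ?thesis .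
  qed
  show ?thesis
    unfolding swap
  proof (rule nn_integral_mono)
    fix l :: real
    show "w l * (\<integral>\<^sup>+\<omega>\<in>A. ennreal (cosh_process l (Suc t) \<omega>) \<partial>M) \<le> w l * (\<integral>\<^sup>+\<omega>\<in>A. ennreal (cosh_process l t \<omega>) \<partial>M)"
    proof (cases "l > 0")
      case True
      then show ?thesis by (intro mult_left_mono cosh_process_supermartingale A) auto
    qed (simp add: w_def)
  qed
qed

text \<open>At time 0 both \<open>snorm\<close> and \<open>nu\<close> vanish, so only the weight is
  integrated: the case \<open>s = 0\<close>, \<open>v = \<theta>\<close> of
  \<open>nn_integral_exp_mixture\<close>.\<close>

lemma mixture_0:
  assumes "\<theta> > 0"
  defines "c \<equiv> \<theta> / B\<^sup>2"
  shows "mixture \<theta> 0 \<omega> = ennreal (exp c / B * (Gamma c * reg_upper_gamma c c / c powr c))"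
  using nn_integral_exp_mixture[OF B_pos order_refl assms(1)]
  by (simp add: mixture_def cosh_process_def snorm_def msum_def nu_def c_def)

definition exp_mixture :: "real \<Rightarrow> nat \<Rightarrow> 'a \<Rightarrow> ennreal" where
  "exp_mixture \<theta> t \<omega> = (\<integral>\<^sup>+l\<in>{0<..}. ennreal (exp (l * snorm t \<omega> - bernstein_rate B l * (nu t \<omega> + \<theta>))) \<partial>lborel)"

lemma exp_mixture_le: "exp_mixture \<theta> t \<omega> \<le> 2 * mixture \<theta> t \<omega>"
proof -
  have "exp_mixture \<theta> t \<omega> \<le> (\<integral>\<^sup>+l. 2 * (ennreal (exp (- bernstein_rate B l * \<theta>)) * ennreal (cosh_process l t \<omega>) * indicator {0<..} l) \<partial>lborel)"
    unfolding exp_mixture_def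
  proof (rule nn_integral_mono)
    fix l
    have "exp (l * snorm t \<omega>) \<le> 2 * cosh (l * snorm t \<omega>)" by (simp add: cosh_field_def)
    then have "exp (l * snorm t \<omega>) * exp (- bernstein_rate B l * (nu t \<omega> + \<theta>)) \<le>
        2 * cosh (l * snorm t \<omega>) * exp (- bernstein_rate B l * (nu t \<omega> + \<theta>))"
      by (intro mult_right_mono) auto
    then have "exp (l * snorm t \<omega> - bernstein_rate B l * (nu t \<omega> + \<theta>)) \<le>
        2 * (exp (- bernstein_rate B l * \<theta>) * cosh_process l t \<omega>)"
      by (simp add: cosh_process_def exp_add[symmetric] exp_diff exp_minus field_simps)
    then have "ennreal (exp (l * snorm t \<omega> - bernstein_rate B l * (nu t \<omega> + \<theta>))) \<le>
        2 * (ennreal (exp (- bernstein_rate B l * \<theta>)) * ennreal (cosh_process l t \<omega>))"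
      by (metis ennreal_leI ennreal_mult' ennreal_numeral exp_ge_zero zero_le_numeral)
    then show "ennreal (exp (l * snorm t \<omega> - bernstein_rate B l * (nu t \<omega> + \<theta>))) * indicator {0<..} l \<le>
        2 * (ennreal (exp (- bernstein_rate B l * \<theta>)) * ennreal (cosh_process l t \<omega>) * indicator {0<..} l)"
      by (auto simp: indicator_def)
  qed
  also have "\<dots> = 2 * mixture \<theta> t \<omega>"
    unfolding mixture_def cosh_process_def by (rule nn_integral_cmult) measurable
  finally show ?thesis .
qed

lemma exp_mixture_measurable: "exp_mixture \<theta> t \<in> borel_measurable M"
proof -
  note [measurable] = measurable_from_subalg[OF filt_sub snorm_measurable[of t]]
    measurable_from_subalg[OF filt_sub nu_measurable[of t t]]
  show ?thesis unfolding exp_mixture_def[abs_def] by measurable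
qed

text \<open>\<open>C\<close> is the initial value of \<open>mixture\<close>, so \<open>Z\<close> is
  the exponential mixture normalised by it. The factor
  \<open>exp (nu t \<omega> / B\<^sup>2)\<close> is what remains of
  \<open>exp (z t \<omega>)\<close> after \<open>exp c\<close> goes into \<open>C\<close>.\<close>

lemma exp_mixture_eq:
  assumes "\<theta> > 0"
  defines "c \<equiv> \<theta> / B\<^sup>2" and "a \<equiv> \<lambda>t \<omega>. (B * snorm t \<omega> + nu t \<omega> + \<theta>) / B\<^sup>2"
    and "z \<equiv> \<lambda>t \<omega>. (nu t \<omega> + \<theta>) / B\<^sup>2"
  defines "C \<equiv> exp c / B * (Gamma c * reg_upper_gamma c c / c powr c)"
    and "Z \<equiv> \<lambda>t \<omega>. c powr c / (Gamma c * reg_upper_gamma c c) *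
      (Gamma (a t \<omega>) * reg_upper_gamma (a t \<omega>) (z t \<omega>) / (z t \<omega>) powr (a t \<omega>)) * exp (nu t \<omega> / B\<^sup>2)"
  shows "C > 0" "exp_mixture \<theta> t \<omega> = ennreal (C * Z t \<omega>)" "0 \<le> Z t \<omega>"
proof -
  have c: "c > 0" using assms B_pos by simp
  then have g0: "Gamma c * reg_upper_gamma c c > 0" by (intro Gamma_reg_upper_gamma_pos)
  have "exp c / B > 0" "Gamma c * reg_upper_gamma c c / c powr c > 0" using divide_pos_pos[OF g0, of "c powr c"] c B_pos by auto
  then show C: "C > 0" unfolding C_def by (rule mult_pos_pos)
  have v: "nu t \<omega> + \<theta> > 0" using nu_nonneg[of t \<omega>] assms by simp
  have za: "z t \<omega> > 0" "a t \<omega> > 0"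
    using v B_pos snorm_nonneg[of t \<omega>] nu_nonneg[of t \<omega>] assms(1)
    by (auto simp: z_def a_def intro!: divide_pos_pos add_nonneg_pos)
  have "Gamma (a t \<omega>) * reg_upper_gamma (a t \<omega>) (z t \<omega>) > 0" using za by (intro Gamma_reg_upper_gamma_pos)
  then show "0 \<le> Z t \<omega>"
    unfolding Z_def using less_imp_le[OF g0] by (simp add: less_imp_le)
  have "exp (z t \<omega>) = exp c * exp (nu t \<omega> / B\<^sup>2)"
    by (simp add: z_def c_def add_divide_distrib flip: exp_add)
  then have "exp (z t \<omega>) / B * (Gamma (a t \<omega>) * reg_upper_gamma (a t \<omega>) (z t \<omega>) / (z t \<omega>) powr (a t \<omega>)) = C * Z t \<omega>"
    using g0 c by (auto simp: C_def Z_def)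
  then show "exp_mixture \<theta> t \<omega> = ennreal (C * Z t \<omega>)"
    unfolding exp_mixture_def
    using nn_integral_exp_mixture[OF B_pos snorm_nonneg[of t \<omega>] v]
    by (simp add: a_def z_def add.assoc)
qed

lemma exp_mixture_sup_bound:
  assumes "0 < \<delta>" and C: "C > 0" "\<And>\<omega>. mixture \<theta> 0 \<omega> = ennreal C"
    and Z: "\<And>t \<omega>. exp_mixture \<theta> t \<omega> = ennreal (C * Z t \<omega>)" "\<And>t \<omega>. 0 \<le> Z t \<omega>"
  shows "prob {\<omega> \<in> space M. (SUP t\<in>{1..}. ereal (Z t \<omega>)) < ereal (2 / \<delta>)} \<ge> 1 - \<delta>"
proof -
  \<comment> \<open>Recovering \<open>Z\<close> from \<open>exp_mixture\<close> yields its
    measurability without any argument about the gamma functions.\<close>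
  have Z_eq: "Z t = (\<lambda>\<omega>. enn2real (exp_mixture \<theta> t \<omega>) / C)" for t
    using C(1) Z by (simp add: fun_eq_iff)
  have [measurable]: "Z t \<in> borel_measurable M" for t
    unfolding Z_eq using exp_mixture_measurable by measurable
  define bad where "bad = {\<omega> \<in> space M. \<not> (SUP t\<in>{1..}. ereal (Z t \<omega>)) < ereal (2 / \<delta>)}"
  have [measurable]: "bad \<in> sets M" unfolding bad_def by measurable
  \<comment> \<open>On \<open>bad\<close> the supremum may equal \<open>2 / \<delta>\<close> without
    being attained, so some \<open>Z t\<close> is only known to exceed \<open>2 * \<eta>\<close> for
    \<open>\<eta>\<close> strictly below \<open>1 / \<delta>\<close>. Ville's inequality is used at
    level \<open>\<eta> * C\<close>, and \<open>\<eta>\<close> is taken close to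
    \<open>1 / \<delta>\<close> afterwards.\<close>
  have markov: "\<eta> * prob bad \<le> 1" if \<eta>: "0 < \<eta>" "\<eta> < 1 / \<delta>" for \<eta>
  proof -
    have "bad \<subseteq> {\<omega> \<in> space M. \<exists>t. ennreal (\<eta> * C) \<le> mixture \<theta> t \<omega>}"
    proof safe
      fix \<omega> assume "\<omega> \<in> bad"
      then have \<omega>: "\<omega> \<in> space M" "ereal (2 / \<delta>) \<le> (SUP t\<in>{1..}. ereal (Z t \<omega>))"
        by (auto simp: bad_def)
      show "\<omega> \<in> space M" by fact
      have "ereal (2 * \<eta>) < ereal (2 / \<delta>)" using \<eta> by simp
      then have "ereal (2 * \<eta>) < (SUP t\<in>{1..}. ereal (Z t \<omega>))" using \<omega>(2) by (rule less_le_trans)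
      then obtain t where t: "2 * \<eta> < Z t \<omega>" by (auto simp: less_SUP_iff)
      have "2 * ennreal (\<eta> * C) = ennreal (C * (2 * \<eta>))"
        using \<eta> C(1) by (simp add: ennreal_mult' mult_ac)
      also have "\<dots> \<le> exp_mixture \<theta> t \<omega>"
        unfolding Z(1) using t C(1) by (intro ennreal_leI mult_left_mono) auto
      also have "\<dots> \<le> 2 * mixture \<theta> t \<omega>" by (rule exp_mixture_le)
      finally have "ennreal (\<eta> * C) \<le> mixture \<theta> t \<omega>"
        by (subst (asm) ennreal_mult_le_mult_iff) auto
      then show "\<exists>t. ennreal (\<eta> * C) \<le> mixture \<theta> t \<omega>" ..
    qed
    moreover have "{\<omega> \<in> space M. \<exists>t. ennreal (\<eta> * C) \<le> mixture \<theta> t \<omega>} \<in> sets M"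
    proof -
      note [measurable] = measurable_from_subalg[OF filt_sub mixture_measurable]
      show ?thesis by measurable
    qed
    ultimately have "emeasure M bad \<le> emeasure M {\<omega> \<in> space M. \<exists>t. ennreal (\<eta> * C) \<le> mixture \<theta> t \<omega>}"
      by (rule emeasure_mono)
    then have "ennreal (\<eta> * C) * emeasure M bad \<le>
        ennreal (\<eta> * C) * emeasure M {\<omega> \<in> space M. \<exists>t. ennreal (\<eta> * C) \<le> mixture \<theta> t \<omega>}"
      by (rule mult_left_mono) simp
    also have "\<dots> \<le> (\<integral>\<^sup>+\<omega>. mixture \<theta> 0 \<omega> \<partial>M)"
      by (rule ville_inequality[where S="mixture \<theta>" and F=F, OF filt_sub filt_mono mixture_measurable mixture_supermartingale])
    also have "\<dots> = ennreal C" by (simp add: C(2) emeasure_space_1)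
    finally have "ennreal (\<eta> * C * prob bad) \<le> ennreal C"
      using \<eta> C(1) by (simp add: emeasure_eq_measure ennreal_mult')
    then have "C * (\<eta> * prob bad) \<le> C * 1" using C(1) by (simp add: ennreal_le_iff mult_ac)
    then show ?thesis using C(1) by (simp only: mult_le_cancel_left_pos)
  qed
  have "prob bad \<le> \<delta>"
  proof (rule ccontr)
    assume "\<not> prob bad \<le> \<delta>"
    then have less: "\<delta> < prob bad" by simp
    then have "1 / prob bad < 1 / \<delta>" using assms(1) by (intro divide_strict_left_mono) auto
    then obtain \<eta> where \<eta>: "1 / prob bad < \<eta>" "\<eta> < 1 / \<delta>" using dense by blast
    moreover have pos: "0 < prob bad" using less assms(1) by linarith
    ultimately have "0 < \<eta>" by (meson less_trans zero_less_divide_1_iff)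
    from markov[OF this \<eta>(2)] \<eta>(1) pos show False by (simp add: field_simps)
  qed
  moreover have "{\<omega> \<in> space M. (SUP t\<in>{1..}. ereal (Z t \<omega>)) < ereal (2 / \<delta>)} = space M - bad"
    by (auto simp: bad_def)
  ultimately show ?thesis by (simp add: prob_compl)
qed

end

theorem theorem4:
  fixes M :: "'a measure"
    and F :: "nat \<Rightarrow> 'a measure"
    and X :: "nat \<Rightarrow> 'a \<Rightarrow> 'h::{real_inner, complete_space, second_countable_topology}"
    and \<epsilon> \<sigma> :: "nat \<Rightarrow> 'a \<Rightarrow> real"
    and B \<rho> \<theta> \<delta> :: real
  assumes "prob_space M"
    and filt_sub: "\<And>t. subalgebra M (F t)"
    and filt_mono: "\<And>s t. s \<le> t \<Longrightarrow> subalgebra (F t) (F s)"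
    and X_meas: "\<And>t. t \<ge> 1 \<Longrightarrow> X t \<in> borel_measurable (F (t - 1))"
    and eps_meas: "\<And>t. t \<ge> 1 \<Longrightarrow> \<epsilon> t \<in> borel_measurable (F t)"
    and eps_mean: "\<And>t. t \<ge> 1 \<Longrightarrow> AE \<omega> in M. real_cond_exp M (F (t - 1)) (\<epsilon> t) \<omega> = 0"
    and B_pos: "B > 0"
    and eps_bdd: "\<And>t \<omega>. t \<ge> 1 \<Longrightarrow> \<omega> \<in> space M \<Longrightarrow> \<bar>\<epsilon> t \<omega>\<bar> \<le> B"
    and sigma_meas: "\<And>t. t \<ge> 1 \<Longrightarrow> \<sigma> t \<in> borel_measurable (F (t - 1))"
    and eps_var: "\<And>t. t \<ge> 1 \<Longrightarrow> AE \<omega> in M. cond_var M (F (t - 1)) (\<epsilon> t) \<omega> \<le> (\<sigma> t \<omega>)\<^sup>2"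
    and rho_pos: "\<rho> > 0"
    and theta_pos: "\<theta> > 0"
    and delta: "0 < \<delta>" "\<delta> < 1"
  shows "let V = (\<lambda>t \<omega> x. \<Sum>i\<in>{1..t}. outer (X i \<omega>) (X i \<omega>) x);
             Mt = (\<lambda>t \<omega>. \<Sum>i\<in>{1..t}. \<epsilon> i \<omega> *\<^sub>R X i \<omega>);
             W = (\<lambda>t \<omega>. inv_sqrt_op (\<lambda>x. \<rho> *\<^sub>R x + V t \<omega> x));
             G = (\<lambda>t \<omega>. W t \<omega> (X t \<omega>));
             s = (\<lambda>t \<omega>. norm (W t \<omega> (Mt t \<omega>)));
             \<nu> = (\<lambda>t \<omega>. \<Sum>i\<in>{1..t}. (\<sigma> i \<omega>)\<^sup>2 * (norm (G i \<omega>))\<^sup>2);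
             c = \<theta> / B\<^sup>2;
             a = (\<lambda>t \<omega>. (B * s t \<omega> + \<nu> t \<omega> + \<theta>) / B\<^sup>2);
             z = (\<lambda>t \<omega>. (\<nu> t \<omega> + \<theta>) / B\<^sup>2);
             Z = (\<lambda>t \<omega>. c powr c / (Gamma c * reg_upper_gamma c c)
                    * (Gamma (a t \<omega>) * reg_upper_gamma (a t \<omega>) (z t \<omega>)
                       / (z t \<omega>) powr (a t \<omega>))
                    * exp (\<nu> t \<omega> / B\<^sup>2))
         in measure M {\<omega> \<in> space M. (SUP t\<in>{1..}. ereal (Z t \<omega>)) < ereal (2 / \<delta>)} \<ge> 1 - \<delta>"
proof -
  interpret prob_space M by fact
  interpret self_normalized M F X \<epsilon> \<sigma> B \<rho>
    by unfold_locales (fact filt_sub filt_mono X_meas eps_meas eps_mean B_pos eps_bdd sigma_meas eps_var rho_pos)+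
  have W: "norm (inv_sqrt_op (\<lambda>x. \<rho> *\<^sub>R x + (\<Sum>i\<in>{1..t}. outer (X i \<omega>) (X i \<omega>) x)) v) = sqrt (v \<bullet> Ri t \<omega> v)" for t \<omega> v
    using norm_inv_sqrt[of \<omega> t v] by (simp add: reg_op_def)
  have s: "norm (inv_sqrt_op (\<lambda>x. \<rho> *\<^sub>R x + (\<Sum>i\<in>{1..t}. outer (X i \<omega>) (X i \<omega>) x)) (\<Sum>i\<in>{1..t}. \<epsilon> i \<omega> *\<^sub>R X i \<omega>)) = snorm t \<omega>" for t \<omega>
    unfolding W by (simp add: snorm_def msum_def)
  have "v \<bullet> Ri t \<omega> v \<ge> 0" for t \<omega> v
    unfolding Ri_def using rho_pos by (rule inner_reg_inv_nonneg)
  then have nu: "(\<Sum>i\<in>{1..t}. (\<sigma> i \<omega>)\<^sup>2 * (norm (inv_sqrt_op (\<lambda>x. \<rho> *\<^sub>R x + (\<Sum>j\<in>{1..i}. outer (X j \<omega>) (X j \<omega>) x)) (X i \<omega>)))\<^sup>2) = nu t \<omega>" for t \<omega>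
    unfolding W nu_def by simp
  show ?thesis
    unfolding Let_def s nu
    by (rule exp_mixture_sup_bound[OF delta(1) exp_mixture_eq(1)[OF theta_pos] mixture_0[OF theta_pos]
          exp_mixture_eq(2,3)[OF theta_pos]])
qed

end
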